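(* Let $m_n$ denote the number of matroids with ground set $\{1,\ldots,n\}$. Then $$\log\log m_n \le n - \frac{3}{2}\log n + \frac{1}{2}\log\frac{2}{\pi} + 1 + o(1)\qquad\text{as } n\to\infty.$$
   Context: $\log$ denotes the logarithm to base 2. Matroids are counted as labelled objects: $m_n$ is the number of distinct matroids (equivalently, distinct collections of independent sets, or of bases) on the fixed ground set $\{1,\ldots,n\}$, not up to isomorphism. The term $o(1)$ denotes a function of $n$ tending to $0$ as $n\to\infty$. *)

theory Defs
  imports Complex_Main
begin

locale matroid =
  fixes E :: "'a set" and indep :: "'a set set"
  assumes finite_ground: "finite E"
    and indep_subset_ground: "X \<in> indep \<Longrightarrow> X \<subseteq> E"
    and empty_indep: "{} \<in> indep"
    and indep_hereditary: "\<lbrakk>X \<in> indep; Y \<subseteq> X\<rbrakk> \<Longrightarrow> Y \<in> indep"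
    and indep_augment: "\<lbrakk>X \<in> indep; Y \<in> indep; card X < card Y\<rbrakk>
      \<Longrightarrow> \<exists>y\<in>Y - X. insert y X \<in> indep"

(* Labelled matroids: distinct independence families on a fixed ground set are
   distinct matroids, even when they are isomorphic. *)
definition matroids_on :: "'a set \<Rightarrow> 'a set set set" where
  "matroids_on E = {indep. matroid E indep}"

definition num_matroids :: "nat \<Rightarrow> nat" where
  "num_matroids n = card (matroids_on {1..n})"

(* card is 0 on infinite sets, so the count is meaningful only because of this. *)
lemma finite_matroids_on:
  assumes "finite E"
  shows "finite (matroids_on E)"
proof (rule finite_subset)
  show "matroids_on E \<subseteq> Pow (Pow E)"
    by (auto simp: matroids_on_def dest: matroid.indep_subset_ground)
  show "finite (Pow (Pow E))"
    using assms by simp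
qed

end

theory Submission
  imports Defs "HOL-Probability.Hoeffding" "HOL-Real_Asymp.Real_Asymp"
begin

text \<open>
  A matroid is determined by its rank \<open>r\<close> and its \<^emph>\<open>nonbases\<close>, the
  dependent sets of size \<open>r\<close>, so the task is to show that few families of
  \<open>r\<close>-sets are families of nonbases. The \<open>r\<close>-sets of an \<open>n\<close>-set
  are the vertices of the Johnson graph, in which the neighbours of \<open>X\<close> are the sets
  \<open>X - e + f\<close>. If the nonbases formed a stable set of this graph, the counting method of
  Kleitman and Winston would apply: a stable set \<open>K\<close> contains a small
  \<^emph>\<open>fingerprint\<close> \<open>S\<close> such that all elements of \<open>K\<close> that
  are neither in \<open>S\<close> nor adjacent to \<open>S\<close> lie in a set \<open>g(S)\<close> of
  size at most \<open>(1 + \<epsilon>) (n choose r) / (n - r + 1)\<close>. No element of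
  \<open>K\<close> is adjacent to \<open>S\<close>, so \<open>K\<close> can be described by
  \<open>S\<close> and a subset of \<open>g(S)\<close>. For \<open>r\<close> near \<open>n/2\<close>
  this gives \<open>(2 + o(1)) (n choose r) / n\<close> bits, which is exactly the bound claimed, since
  \<open>n choose (n div 2)\<close> is asymptotic to \<open>2^n sqrt (2 / (\<pi> n))\<close>.

  The procedure that finds the fingerprint works for every set \<open>K\<close> of vertices, stable or
  not (\<open>container_fingerprint\<close>), but then the part of \<open>K\<close> in the neighbourhood
  of \<open>S\<close> is not determined by \<open>S\<close>. This is where matroid structure enters. Let
  \<open>X\<close> be a nonbasis, let \<open>P\<close> be the set of all \<open>e \<in> X\<close> whose
  removal never leads to a neighbouring basis, and \<open>Q\<close> the set of all \<open>f \<notin>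
  X\<close> whose addition never does. Then \<open>X - e + f\<close> is a nonbasis if and only if
  \<open>e \<in> P\<close> or \<open>f \<in> Q\<close> (\<open>swap_indep_iff\<close>). So the nonbases
  around \<open>X\<close> are described by the pair \<open>(P, Q)\<close>. Up to \<open>n\<close> bits
  for such a pair would be too expensive, as there can be about \<open>(n choose r) ln n / n^2\<close>
  elements of \<open>S\<close>. If no neighbour of \<open>X\<close> is a basis, it is enough to say so.
  Otherwise, if \<open>P\<close> is large, then \<open>X - P\<close> is a dependent set of unusually
  small size, and if \<open>Q\<close> is large, then \<open>X \<union> Q\<close> is an unusually large
  set without a basis inside. There are so few sets of such extreme sizes in total (Hoeffding's
  inequality) that the family of all those without a comparable basis can be recorded once, for the
  whole matroid. Only pairs of sets of size at most \<open>t = 2 n^(3/4)\<close> are recorded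
  individually, at \<open>O(t log n)\<close> bits each, a total of \<open>o((n choose r) / n)\<close>
  (\<open>card_nonbases_families_le\<close>).

  Finally, ranks that differ from \<open>n/2\<close> by at least \<open>n^(3/4)\<close> contribute next
  to nothing, because then there are few \<open>r\<close>-sets at all, and summing over the ranks costs
  only a factor \<open>n + 1\<close>.
\<close>

section \<open>Central binomial coefficients and binomial tails\<close>

lemma central_binomial_Suc:
  "real (2 * Suc m choose Suc m) * real (m + 1) = 2 * real (2 * m + 1) * real (2 * m choose m)"
proof -
  have "(2 * Suc m choose Suc m) = 2 * (Suc (2 * m) choose Suc m)"
    using binomial_symmetric[of m "Suc (2 * m)"] by simp
  moreover have "Suc m * (Suc (2 * m) choose Suc m) = Suc (2 * m) * (2 * m choose m)"
    by (rule Suc_times_binomial)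
  ultimately have "(2 * Suc m choose Suc m) * Suc m = 2 * (Suc (2 * m) * (2 * m choose m))"
    by (metis mult.commute mult.left_commute)
  then have "real ((2 * Suc m choose Suc m) * Suc m) = real (2 * (Suc (2 * m) * (2 * m choose m)))"
    by (rule arg_cong)
  then show ?thesis by (simp only: of_nat_mult) simp
qed

text \<open>
  The left-hand side is the normalized square of the central binomial coefficient; both sides start
  at 1 and have the same ratio of consecutive terms. Through Wallis' product this replaces Stirling's
  formula.
\<close>

lemma central_binomial_wallis:
  "real (2 * m choose m) ^ 2 * real (2 * m + 1) / 16 ^ m =
    inverse (\<Prod>k=1..m. (4 * real k ^ 2) / (4 * real k ^ 2 - 1))"
proof (induction m)
  case (Suc m)
  define c where "c = real (2 * m choose m)"
  have c': "real (2 * Suc m choose Suc m) = 2 * real (2 * m + 1) * c / real (m + 1)"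
    using central_binomial_Suc[of m] by (simp add: c_def field_simps del: binomial_Suc_Suc)
  have "real (2 * Suc m choose Suc m) ^ 2 * real (2 * Suc m + 1) / 16 ^ Suc m
      = c ^ 2 * real (2 * m + 1) / 16 ^ m *
        ((2 * real m + 1) * (2 * real m + 3) / (4 * (real m + 1) ^ 2))"
  proof -
    define x p where "x = real m" and "p = (16::real) ^ m"
    have "x + 1 \<noteq> 0" "p \<noteq> 0" by (simp_all add: x_def p_def)
    then have "(2 * (2 * x + 1) * c / (x + 1)) ^ 2 * (2 * x + 3) / (16 * p)
      = c ^ 2 * (2 * x + 1) / p * ((2 * x + 1) * (2 * x + 3) / (4 * (x + 1) ^ 2))"
      by (simp add: divide_simps) (simp add: power2_eq_square algebra_simps)
    then show ?thesis unfolding c' by (simp add: x_def p_def add.commute)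
  qed
  also have "(2 * real m + 1) * (2 * real m + 3) / (4 * (real m + 1) ^ 2)
      = inverse (4 * real (Suc m) ^ 2 / (4 * real (Suc m) ^ 2 - 1))"
    by (simp add: field_simps power2_eq_square)
  also have "c ^ 2 * real (2 * m + 1) / 16 ^ m = inverse (\<Prod>k=1..m. (4 * real k ^ 2) / (4 * real k ^ 2 - 1))"
    using Suc by (simp only: c_def)
  finally show ?case
    using prod.nat_ivl_Suc'[of 1 m "\<lambda>k. (4 * real k ^ 2) / (4 * real k ^ 2 - 1)"]
    by (simp only: inverse_mult_distrib mult.commute Suc_le_mono le0 simp_thms One_nat_def)
qed simp

text \<open>
  For odd \<open>n\<close> the middle coefficient is half of the next central one, and for both parities
  this amounts to rounding \<open>n / 2\<close> up. A single formula therefore covers all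
  \<open>n\<close>.
\<close>

lemma central_binomial_ceiling:
  defines "m \<equiv> \<lambda>n::nat. (n + 1) div 2"
  assumes "n > 0"
  shows "real (n choose (n div 2)) * sqrt (real n) / 2 ^ n =
    sqrt (real (2 * m n choose m n) ^ 2 * real (2 * m n + 1) / 16 ^ m n * (real n / real (2 * m n + 1)))"
proof -
  have "real (2 * m n choose m n) / 4 ^ m n = real (n choose (n div 2)) / 2 ^ n"
  proof (cases "even n")
    case True
    then have "2 * m n = n" "m n = n div 2" by (auto simp: m_def)
    then show ?thesis 
      using power_mult[of "2 :: real" 2 "m n"] by simp
  next
    case False
    then obtain k where k: "n = Suc (2 * k)" by (metis oddE Suc_eq_plus1)
    then have "m n = Suc k" by (simp add: m_def)
    moreover have "(2 * Suc k choose Suc k) = 2 * (Suc (2 * k) choose k)"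
      using binomial_symmetric[of k "Suc (2 * k)"] by simp
    moreover have "(2::real) ^ n = 2 * 4 ^ k" by (simp add: k power_mult)
    moreover have "n div 2 = k" using k by simp
    ultimately show ?thesis using k by (simp del: binomial_Suc_Suc)
  qed
  moreover have "(16::real) ^ m n = (4 ^ m n) ^ 2"
    by (simp add: power2_eq_square flip: power_mult_distrib)
  then have "real (2 * m n choose m n) ^ 2 * real (2 * m n + 1) / 16 ^ m n * (real n / real (2 * m n + 1))
    = (real (2 * m n choose m n) / 4 ^ m n) ^ 2 * real n"
    by (simp add: power_divide)
  ultimately show ?thesis by (simp add: real_sqrt_mult)
qed

lemma central_binomial_limit:
  "(\<lambda>n. real (n choose (n div 2)) * sqrt (real n) / 2 ^ n) \<longlonglongrightarrow> sqrt (2 / pi)"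
proof -
  define m where "m n = (n + 1) div 2" for n :: nat
  have m: "filterlim m sequentially sequentially"
    unfolding filterlim_at_top
  proof
    fix Z show "\<forall>\<^sub>F n in sequentially. Z \<le> m n"
      using eventually_ge_at_top[of "2 * Z"] by eventually_elim (auto simp: m_def)
  qed
  have "(\<lambda>m. real (2 * m choose m) ^ 2 * real (2 * m + 1) / 16 ^ m) \<longlonglongrightarrow> inverse (pi / 2)"
    unfolding central_binomial_wallis by (intro tendsto_inverse wallis) auto
  from filterlim_compose[OF this m]
  have 1: "(\<lambda>n. real (2 * m n choose m n) ^ 2 * real (2 * m n + 1) / 16 ^ m n) \<longlonglongrightarrow> 2 / pi"
    by simp
  have 2: "(\<lambda>n. real n / real (2 * m n + 1)) \<longlonglongrightarrow> 1"
  proof (rule tendsto_sandwich)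
    show "(\<lambda>n. real n / (real n + 2)) \<longlonglongrightarrow> 1" by real_asymp
    show "(\<lambda>n. real n / (real n + 1)) \<longlonglongrightarrow> 1" by real_asymp
    have m: "n + 1 \<le> 2 * m n + 1" "2 * m n + 1 \<le> n + 2" for n by (auto simp: m_def)
    have m': "real n + 1 \<le> real (2 * m n + 1)" "real (2 * m n + 1) \<le> real n + 2" for n
      using m[of n] by linarith+
    show "\<forall>\<^sub>F n in sequentially. real n / (real n + 2) \<le> real n / real (2 * m n + 1)"
      using m' by (intro always_eventually allI divide_left_mono) (auto simp del: of_nat_add of_nat_mult)
    show "\<forall>\<^sub>F n in sequentially. real n / real (2 * m n + 1) \<le> real n / (real n + 1)"
      using m' by (intro always_eventually allI divide_left_mono) (auto simp del: of_nat_add of_nat_mult)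
  qed
  have "(\<lambda>n. sqrt (real (2 * m n choose m n) ^ 2 * real (2 * m n + 1) / 16 ^ m n * (real n / real (2 * m n + 1))))
      \<longlonglongrightarrow> sqrt (2 / pi * 1)"
    by (intro tendsto_intros 1 2)
  moreover have "\<forall>\<^sub>F n in sequentially.
     sqrt (real (2 * m n choose m n) ^ 2 * real (2 * m n + 1) / 16 ^ m n * (real n / real (2 * m n + 1)))
      = real (n choose (n div 2)) * sqrt (real n) / 2 ^ n"
    using eventually_gt_at_top[of 0]
    by eventually_elim (simp add: central_binomial_ceiling m_def)
  ultimately show ?thesis by (simp add: filterlim_cong)
qed

lemma two_power_le_central:
  "2 ^ n \<le> real (n + 1) * real (n choose (n div 2))"
proof -
  have "(2::nat) ^ n = (\<Sum>k\<le>n. n choose k)" by (simp add: choose_row_sum)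
  also have "\<dots> \<le> (\<Sum>k\<le>n. n choose (n div 2))" by (intro sum_mono binomial_maximum)
  also have "\<dots> = (n + 1) * (n choose (n div 2))" by simp
  finally have "real (2 ^ n) \<le> real ((n + 1) * (n choose (n div 2)))" by (rule of_nat_mono)
  then show ?thesis by (simp only: of_nat_mult of_nat_power of_nat_numeral)
qed

text \<open>
  The size of a uniformly random subset is binomially distributed, so this is Hoeffding's inequality.
\<close>

lemma card_tail:
  fixes u :: real
  assumes "finite E" "card E = n" "n > 0" "u \<ge> 0"
  shows "real (card {X. X \<subseteq> E \<and> \<bar>real (card X) - real n / 2\<bar> \<ge> u}) \<le> 2 * 2 ^ n * exp (- 2 * u\<^sup>2 / real n)"
proof -
  let ?p = "binomial_pmf n (1/2)"
  let ?J = "{k\<in>{..n}. \<bar>real k - real n / 2\<bar> \<ge> u}"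
  interpret binomial_distribution n "1/2"
    by unfold_locales auto
  have "{X. X \<subseteq> E \<and> \<bar>real (card X) - real n / 2\<bar> \<ge> u} = (\<Union>k\<in>?J. {X. X \<subseteq> E \<and> card X = k})"
    using assms card_mono by fastforce
  also have "card \<dots> \<le> (\<Sum>k\<in>?J. card {X. X \<subseteq> E \<and> card X = k})"
    by (intro card_UN_le) auto
  also have "\<dots> = (\<Sum>k\<in>?J. n choose k)"
    using assms by (simp add: n_subsets)
  finally have "real (card {X. X \<subseteq> E \<and> \<bar>real (card X) - real n / 2\<bar> \<ge> u}) \<le> (\<Sum>k\<in>?J. real (n choose k))"
    by (simp flip: of_nat_sum)
  also have "\<dots> = 2 ^ n * (\<Sum>k\<in>?J. pmf ?p k)"
    unfolding sum_distrib_left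
  proof (intro sum.cong refl)
    fix k assume "k \<in> ?J"
    then have k: "k \<le> n" by simp
    have "(1 / 2 :: real) ^ k * (1 / 2) ^ (n - k) = (1 / 2) ^ n"
      using k by (simp flip: power_add)
    then show "real (n choose k) = 2 ^ n * pmf ?p k"
      using k by (simp add: field_simps)
  qed
  also have "(\<Sum>k\<in>?J. pmf ?p k) = measure_pmf.prob ?p ?J"
    by (simp add: measure_measure_pmf_finite)
  also have "\<dots> \<le> measure_pmf.prob ?p {x. \<bar>real x - real n * (1 / 2)\<bar> \<ge> u}"
    by (intro measure_pmf.finite_measure_mono) auto
  also have "\<dots> \<le> 2 * exp (- 2 * u\<^sup>2 / real n)"
    using prob_abs_ge[of u] assms by simp
  finally show ?thesis by (simp add: mult_ac)
qed

section \<open>Counting small subsets\<close>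

lemma sum_power_card_Pow:
  fixes x :: "'b :: comm_semiring_1"
  assumes "finite W"
  shows "(\<Sum>S\<in>Pow W. x ^ card S) = (1 + x) ^ card W"
  using assms
proof (induction W)
  case (insert a W)
  have "(\<Sum>S\<in>Pow (insert a W). x ^ card S) = (\<Sum>S\<in>Pow W. x ^ card S) + (\<Sum>S\<in>insert a ` Pow W. x ^ card S)"
    using insert.hyps unfolding Pow_insert by (intro sum.union_disjoint) auto
  also have "(\<Sum>S\<in>insert a ` Pow W. x ^ card S) = (\<Sum>S\<in>Pow W. x ^ card (insert a S))"
    using insert.hyps by (subst sum.reindex) (auto simp: inj_on_def)
  also have "\<dots> = (\<Sum>S\<in>Pow W. x * x ^ card S)"
    using insert.hyps by (intro sum.cong refl) (subst card_insert_disjoint, auto dest: finite_subset)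
  finally show ?case
    using insert by (simp add: sum_distrib_left[symmetric] algebra_simps)
qed auto

text \<open>
  Every subset counted has weight \<open>x ^ card S \<ge> x powr \<sigma>\<close>, while all subsets of
  \<open>W\<close> together have weight \<open>(1 + x) ^ card W\<close>. The bound is best for \<open>x
  = \<sigma> / card W\<close>; leaving \<open>x\<close> free permits values that are easier to handle.
\<close>

lemma card_small_subsets:
  fixes x \<sigma> :: real
  assumes "finite W" "0 < x" "x \<le> 1"
  shows "real (card {S. S \<subseteq> W \<and> real (card S) \<le> \<sigma>}) \<le> x powr (-\<sigma>) * exp (x * real (card W))"
proof -
  let ?F = "{S. S \<subseteq> W \<and> real (card S) \<le> \<sigma>}"
  have fin: "finite (Pow W)" using assms by simp
  have "x powr \<sigma> * real (card ?F) = (\<Sum>S\<in>?F. x powr \<sigma>)"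
    by simp
  also have "\<dots> \<le> (\<Sum>S\<in>?F. x powr real (card S))"
    using assms by (intro sum_mono powr_mono') auto
  also have "\<dots> = (\<Sum>S\<in>?F. x ^ card S)"
    using assms by (simp add: powr_realpow)
  also have "\<dots> \<le> (\<Sum>S\<in>Pow W. x ^ card S)"
    using assms fin by (intro sum_mono2) auto
  also have "\<dots> = (1 + x) ^ card W"
    using assms by (simp add: sum_power_card_Pow)
  also have "\<dots> \<le> exp x ^ card W"
    using assms by (intro power_mono) (auto simp: exp_ge_add_one_self)
  also have "\<dots> = exp (x * real (card W))"
    by (simp add: exp_of_nat_mult[symmetric] mult.commute)
  finally show ?thesis
    using assms by (simp add: powr_minus field_simps)
qed

section \<open>Fingerprints and containers\<close>

text \<open>
  \<open>N v\<close> plays the role of the closed neighbourhood of \<open>v\<close> in a graph on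
  \<open>V\<close>. As long as the current vertex set \<open>V\<close> has more than \<open>T\<close>
  elements, choose a vertex \<open>v\<close> of high degree. If \<open>v \<notin> K\<close>, discard
  \<open>v\<close>; if \<open>v \<in> K\<close>, put \<open>v\<close> into the fingerprint
  \<open>S\<close> and discard all of \<open>N v\<close>. The choice of \<open>v\<close> does not look
  at \<open>K\<close>, and membership of \<open>v\<close> in \<open>K\<close> is the same as membership
  in \<open>S\<close>, so the final vertex set is a function \<open>g\<close> of \<open>S\<close> alone.
  Each element of \<open>S\<close> shrinks the vertex set by the factor \<open>1 - \<beta> \<le> exp (-
  \<beta>)\<close>, and before the last one was chosen there were still more than \<open>T\<close>
  vertices: this bounds \<open>card S\<close>.
\<close>

lemma container_fingerprint:
  fixes N :: "'a \<Rightarrow> 'a set" and T \<beta> :: real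
  assumes "finite V"
    and dense: "\<And>A. A \<subseteq> V \<Longrightarrow> real (card A) > T \<Longrightarrow>
      \<exists>v\<in>A. v \<in> N v \<and> real (card (A \<inter> N v)) \<ge> \<beta> * real (card A)"
  shows "\<exists>g. (\<forall>S. g S \<subseteq> V \<and> real (card (g S)) \<le> T) \<and>
    (\<forall>K\<subseteq>V. \<exists>S\<subseteq>K. K \<subseteq> g S \<union> \<Union>(N ` S) \<and>
        (S = {} \<or> T * exp (\<beta> * (real (card S) - 1)) < real (card V)))"
  using assms
proof (induction "card V" arbitrary: V rule: less_induct)
  case less
  let ?P = "\<lambda>V g. (\<forall>S. g S \<subseteq> V \<and> real (card (g S)) \<le> T) \<and>
    (\<forall>K\<subseteq>V. \<exists>S\<subseteq>K. K \<subseteq> g S \<union> \<Union>(N ` S) \<and>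
      (S = {} \<or> T * exp (\<beta> * (real (card S) - 1)) < real (card V)))"
  show ?case
  proof (cases "real (card V) \<le> T")
    case True
    then show ?thesis
      by (intro exI[of _ "\<lambda>_. V"] conjI allI impI exI[of _ "{}"]) simp_all
  next
    case False
    then have big: "real (card V) > T" by simp
    obtain v where v: "v \<in> V" "v \<in> N v" "real (card (V \<inter> N v)) \<ge> \<beta> * real (card V)"
      using less.prems(2)[OF subset_refl big] by blast
    have "card (V - N v) + card (V \<inter> N v) = card V"
      using card_Diff_subset_Int[of V "N v"] less.prems(1) card_mono[of V "V \<inter> N v"] by auto
    then have "real (card (V - N v)) + real (card (V \<inter> N v)) = real (card V)"
      by linarith
    then have "real (card (V - N v)) \<le> (1 + - \<beta>) * real (card V)"
      using v(3) by (simp add: algebra_simps)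
    also have "\<dots> \<le> exp (- \<beta>) * real (card V)"
      by (intro mult_right_mono exp_ge_add_one_self) auto
    finally have shrink: "exp \<beta> * real (card (V - N v)) \<le> real (card V)"
      by (simp add: exp_minus field_simps)
    have "V - {v} \<subset> V" "V - N v \<subset> V" using v by auto
    then have smaller: "card (V - {v}) < card V" "card (V - N v) < card V"
      using less.prems(1) psubset_card_mono by blast+
    have IH: "\<exists>g. ?P V' g" if "V' \<subseteq> V" "card V' < card V" for V'
    proof (rule less.hyps)
      show "finite V'" using that(1) less.prems(1) by (rule finite_subset)
      show "\<exists>v\<in>A. v \<in> N v \<and> real (card (A \<inter> N v)) \<ge> \<beta> * real (card A)"
        if "A \<subseteq> V'" "real (card A) > T" for A
        using that \<open>V' \<subseteq> V\<close> by (intro less.prems(2)) auto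
    qed fact
    obtain g1 where g1: "?P (V - {v}) g1" using IH[OF _ smaller(1)] by blast
    obtain g2 where g2: "?P (V - N v) g2" using IH[OF _ smaller(2)] by blast
    define g where "g S = (if v \<in> S then g2 (S - {v}) else g1 S)" for S
    show ?thesis
    proof (intro exI[of _ g] conjI allI impI)
      show "g S \<subseteq> V" "real (card (g S)) \<le> T" for S
        using conjunct1[OF g1, rule_format, of S] conjunct1[OF g2, rule_format, of "S - {v}"]
        by (auto simp: g_def)
    next
      fix K assume K: "K \<subseteq> V"
      show "\<exists>S\<subseteq>K. K \<subseteq> g S \<union> \<Union>(N ` S) \<and>
        (S = {} \<or> T * exp (\<beta> * (real (card S) - 1)) < real (card V))"
      proof (cases "v \<in> K")
        case False
        then obtain S where S: "S \<subseteq> K" "K \<subseteq> g1 S \<union> \<Union>(N ` S)"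
          "S = {} \<or> T * exp (\<beta> * (real (card S) - 1)) < real (card (V - {v}))"
          using conjunct2[OF g1, rule_format, of K] K by blast
        have "g S = g1 S"
          using S(1) False by (auto simp: g_def)
        then show ?thesis using S smaller(1) by (intro exI[of _ S]) auto
      next
        case True
        obtain S where S: "S \<subseteq> K - N v" "K - N v \<subseteq> g2 S \<union> \<Union>(N ` S)"
          "S = {} \<or> T * exp (\<beta> * (real (card S) - 1)) < real (card (V - N v))"
          using conjunct2[OF g2, rule_format, of "K - N v"] K by blast
        have vS: "v \<notin> S" "finite S"
          using S(1) v(2) K less.prems(1) by (auto dest: finite_subset)
        have "g (insert v S) = g2 S"
          using vS by (simp add: g_def)
        moreover have "T * exp (\<beta> * real (card S)) < real (card V)"
        proof (cases "S = {}")
          case True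
          then show ?thesis using big by simp
        next
          case False
          have "T * exp (\<beta> * real (card S)) = exp \<beta> * (T * exp (\<beta> * (real (card S) - 1)))"
            by (simp add: algebra_simps exp_diff)
          also have "\<dots> < exp \<beta> * real (card (V - N v))"
            using S(3) False by (intro mult_strict_left_mono) auto
          also note shrink
          finally show ?thesis .
        qed
        ultimately show ?thesis using S True vS
          by (intro exI[of _ "insert v S"]) auto
      qed
    qed
  qed
qed

section \<open>Supersaturation in the Johnson graph\<close>

text \<open>
  The closed neighbourhood of \<open>X\<close> in the Johnson graph on the subsets of \<open>E\<close>
  of size \<open>card X\<close>.
\<close>

definition johnson_ball :: "'a set \<Rightarrow> 'a set \<Rightarrow> 'a set set" where
  "johnson_ball E X = insert X {insert f (X - {e}) |e f. e \<in> X \<and> f \<in> E - X}"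

lemma choose_pred: "1 \<le> r \<Longrightarrow> r choose (r - 1) = r"
  by (cases r) auto

text \<open>
  The \<open>r\<close>-sets containing a fixed \<open>(r - 1)\<close>-set form a clique, and every edge
  of the Johnson graph lies in exactly one of these cliques, the one given by the intersection of its
  ends. Summing over the \<open>r\<close> cliques through \<open>X\<close> therefore counts
  \<open>X\<close> itself \<open>r\<close> times and every neighbour once.
\<close>

lemma sum_card_cliques_le:
  assumes "finite E" "1 \<le> r" "A \<subseteq> {X. X \<subseteq> E \<and> card X = r}" "X \<in> A"
  shows "(\<Sum>Z | Z \<subseteq> X \<and> card Z = r - 1. card {Y\<in>A. Z \<subseteq> Y}) \<le> r + card (A \<inter> johnson_ball E X)"
proof -
  let ?Z = "{Z. Z \<subseteq> X \<and> card Z = r - 1}"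
  have finA: "finite A"
    using assms(1,3) by (intro finite_subset[OF _ finite_Pow_iff[THEN iffD2, OF assms(1)]]) auto
  have X_size: "X \<subseteq> E" "card X = r" using assms by auto
  then have "finite X" using assms(1) finite_subset by blast
  note X = X_size this
  have finZ: "finite ?Z" using X by (intro finite_subset[of ?Z "Pow X"]) auto
  have cardZ: "card ?Z = r"
    using X assms(2) by (simp add: n_subsets choose_pred del: One_nat_def)
  have inter: "Z = X \<inter> Y" if "Z \<in> ?Z" "Y \<in> A" "Z \<subseteq> Y" "Y \<noteq> X" for Z Y
  proof -
    have Y: "card Y = r" "finite Y" using that assms finite_subset[of Y E] by blast+
    have "X \<inter> Y \<noteq> X"
      using that(4) Y X by (metis card_subset_eq inf.absorb_iff1 inf_commute)
    then have "card (X \<inter> Y) < r" using X by (metis psubset_card_mono inf_le1 psubsetI)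
    then have "card (X \<inter> Y) \<le> card Z" using that by auto
    moreover have "Z \<subseteq> X \<inter> Y" using that by auto
    ultimately show ?thesis using X by (intro card_seteq) auto
  qed
  have ball: "Y \<in> johnson_ball E X" if "Z \<in> ?Z" "Y \<in> A" "Z \<subseteq> Y" "Y \<noteq> X" for Z Y
  proof -
    have Y: "card Y = r" "finite Y" "Y \<subseteq> E" using that assms finite_subset[of Y E] by blast+
    have finZ': "finite Z" using that X finite_subset by blast
    have "card (X - Z) = 1" "card (Y - Z) = 1"
      using that X Y finZ' assms(2) by (auto simp: card_Diff_subset)
    then obtain e f where e: "X - Z = {e}" and f: "Y - Z = {f}"
      by (auto simp: card_1_singleton_iff)
    have "Y = insert f (X - {e})" "e \<in> X" using e f that by auto
    moreover have "f \<in> E - X"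
    proof -
      have "f \<notin> X" using inter[OF that] f by auto
      then show ?thesis using f Y by auto
    qed
    ultimately show ?thesis by (auto simp: johnson_ball_def)
  qed
  have "(\<Sum>Z\<in>?Z. card {Y\<in>A. Z \<subseteq> Y}) \<le> (\<Sum>Z\<in>?Z. 1 + card {Y\<in>A. Z \<subseteq> Y \<and> Y \<noteq> X})"
  proof (intro sum_mono)
    fix Z assume "Z \<in> ?Z"
    have "card {Y\<in>A. Z \<subseteq> Y} \<le> card (insert X {Y\<in>A. Z \<subseteq> Y \<and> Y \<noteq> X})"
      using finA by (intro card_mono) auto
    also have "\<dots> = 1 + card {Y\<in>A. Z \<subseteq> Y \<and> Y \<noteq> X}"
      using finA by simp
    finally show "card {Y\<in>A. Z \<subseteq> Y} \<le> \<dots>" .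
  qed
  also have "\<dots> = r + (\<Sum>Z\<in>?Z. card {Y\<in>A. Z \<subseteq> Y \<and> Y \<noteq> X})"
    using cardZ by (simp only: sum.distrib) simp
  also have "(\<Sum>Z\<in>?Z. card {Y\<in>A. Z \<subseteq> Y \<and> Y \<noteq> X}) = card (\<Union>Z\<in>?Z. {Y\<in>A. Z \<subseteq> Y \<and> Y \<noteq> X})"
  proof (rule card_UN_disjoint[symmetric])
    show "\<forall>Z\<in>?Z. \<forall>Z'\<in>?Z. Z \<noteq> Z' \<longrightarrow>
      {Y\<in>A. Z \<subseteq> Y \<and> Y \<noteq> X} \<inter> {Y\<in>A. Z' \<subseteq> Y \<and> Y \<noteq> X} = {}"
      using inter by blast
  qed (use finA finZ in auto)
  also have "\<dots> \<le> card (A \<inter> johnson_ball E X)"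
    using finA ball by (intro card_mono) auto
  finally show ?thesis by simp
qed

text \<open>
  There are \<open>r (n choose r) / q\<close> cliques, and \<open>A\<close> meets them in \<open>r *
  card A\<close> incidences. If \<open>A\<close> has more than \<open>(n choose r) / q\<close> elements,
  then an average clique contains more than one element of \<open>A\<close>, and the Cauchy-Schwarz
  inequality turns this into many pairs of adjacent elements. Up to the factor \<open>1 +
  \<epsilon>\<close>, the threshold is the largest size that the cliques permit for a stable set.
\<close>

lemma johnson_supersaturation:
  fixes \<epsilon> :: real
  defines "q \<equiv> \<lambda>n r. real (n - r + 1)"
  assumes E: "finite E" "card E = n" and r: "1 \<le> r" "r \<le> n"
    and A: "A \<subseteq> {X. X \<subseteq> E \<and> card X = r}" and "\<epsilon> > 0"
    and big: "real (card A) > (1 + \<epsilon>) * real (n choose r) / q n r"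
  shows "\<exists>X\<in>A. real (card (A \<inter> johnson_ball E X))
      \<ge> \<epsilon> * real r * q n r / ((1 + \<epsilon>) * real (n choose r)) * real (card A)"
proof (rule ccontr)
  define N where "N = real (n choose r)"
  define a where "a = real (card A)"
  define \<beta> where "\<beta> = \<epsilon> * real r * q n r / ((1 + \<epsilon>) * N)"
  assume "\<not> ?thesis"
  then have small: "real (card (A \<inter> johnson_ball E X)) \<le> \<beta> * a" if "X \<in> A" for X
    using that by (auto simp: N_def a_def \<beta>_def not_le less_imp_le)
  let ?Z = "{Z. Z \<subseteq> E \<and> card Z = r - 1}"
  let ?c = "\<lambda>Z. card {Y\<in>A. Z \<subseteq> Y}"
  have N: "N > 0" using r by (simp add: N_def)
  have q: "q n r > 0" by (simp add: q_def)
  have finZ: "finite ?Z" and finA: "finite A"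
    by (rule finite_subset[of _ "Pow E"]; use E A in auto)+
  have below: "{Z\<in>?Z. Z \<subseteq> X} = {Z. Z \<subseteq> X \<and> card Z = r - 1}" if "X \<in> A" for X
    using that A by auto
  \<comment> \<open>Double counting of the incidences between \<open>A\<close> and the cliques.\<close>
  have swap: "(\<Sum>Z\<in>?Z. \<Sum>Y\<in>{Y\<in>A. Z \<subseteq> Y}. g Z) = (\<Sum>Y\<in>A. \<Sum>Z | Z \<subseteq> Y \<and> card Z = r - 1. g Z)"
    for g :: "'a set \<Rightarrow> nat"
  proof -
    have "(\<Sum>Z\<in>?Z. \<Sum>Y\<in>{Y\<in>A. Z \<subseteq> Y}. g Z) = (\<Sum>Y\<in>A. \<Sum>Z\<in>{Z\<in>?Z. Z \<subseteq> Y}. g Z)"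
      using finA finZ by (rule sum.swap_restrict[symmetric])
    then show ?thesis using below by simp
  qed
  have "(\<Sum>Z\<in>?Z. ?c Z) = (\<Sum>Y\<in>A. \<Sum>Z | Z \<subseteq> Y \<and> card Z = r - 1. 1)"
    using swap[of "\<lambda>_. 1"] by simp
  also have "\<dots> = (\<Sum>Y\<in>A. r)"
  proof (intro sum.cong refl)
    fix Y assume "Y \<in> A"
    then have "Y \<subseteq> E" "card Y = r" using A by auto
    then have "finite Y" "card Y = r" using E(1) finite_subset by auto
    then show "(\<Sum>Z | Z \<subseteq> Y \<and> card Z = r - 1. 1) = r"
      using r by (simp add: n_subsets choose_pred del: One_nat_def)
  qed
  finally have first: "(\<Sum>Z\<in>?Z. ?c Z) = r * card A" by simp
  have "(\<Sum>Z\<in>?Z. (?c Z)\<^sup>2) = (\<Sum>Y\<in>A. \<Sum>Z | Z \<subseteq> Y \<and> card Z = r - 1. ?c Z)"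
    using swap[of ?c] by (simp add: power2_eq_square)
  also have "\<dots> \<le> (\<Sum>Y\<in>A. r + card (A \<inter> johnson_ball E Y))"
    using sum_card_cliques_le[OF E(1) r(1) A] by (intro sum_mono) auto
  finally have "real (\<Sum>Z\<in>?Z. (?c Z)\<^sup>2) \<le> real (\<Sum>Y\<in>A. r + card (A \<inter> johnson_ball E Y))"
    by (simp only: of_nat_le_iff)
  also have "\<dots> \<le> (\<Sum>Y\<in>A. real r + \<beta> * a)"
    using small by (simp only: of_nat_sum of_nat_add) (intro sum_mono add_left_mono)
  finally have second: "real (\<Sum>Z\<in>?Z. (?c Z)\<^sup>2) \<le> a * (real r + \<beta> * a)"
    by (simp add: a_def)
  have "(r * a)\<^sup>2 = (\<Sum>Z\<in>?Z. real (?c Z))\<^sup>2"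
    using first by (simp add: a_def flip: of_nat_sum)
  also have "\<dots> \<le> (\<Sum>Z\<in>?Z. (real (?c Z))\<^sup>2) * real (card ?Z)"
    by (rule sum_squared_le_sum_of_squares)
  also have "\<dots> \<le> a * (real r + \<beta> * a) * real (card ?Z)"
    using second by (intro mult_right_mono) auto
  finally have CS: "(r * a)\<^sup>2 \<le> a * (real r + \<beta> * a) * real (card ?Z)" .
  \<comment> \<open>Both sides count the pairs of an \<open>(r - 1)\<close>-set and an \<open>r\<close>-set containing it.\<close>
  have "card ?Z * (n - r + 1) = r * (n choose r)"
  proof -
    obtain k where k: "r = Suc k" using r by (cases r) auto
    have "Suc k * (n choose Suc k) = (n - k) * (n choose k)"
      using binomial_absorb_comp[of n k] binomial_absorption[of k n] by (simp add: mult.commute)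
    then show ?thesis using E r k by (simp add: n_subsets Suc_diff_Suc mult.commute)
  qed
  then have cardZ: "real (card ?Z) * q n r = r * N"
    unfolding q_def N_def by (metis of_nat_mult)
  have big': "a * q n r > (1 + \<epsilon>) * N"
    using big q by (simp add: a_def N_def field_simps)
  moreover have "(1 + \<epsilon>) * N > 0" using N assms by simp
  ultimately have a: "a > 0" using q by (smt (verit) mult_nonpos_nonneg)
  have "(r * a)\<^sup>2 * q n r \<le> a * (real r + \<beta> * a) * real (card ?Z) * q n r"
    using CS q by (intro mult_right_mono) auto
  also have "\<dots> = a * (real r + \<beta> * a) * (r * N)"
    using cardZ by (simp add: mult.assoc)
  finally have "(a * r) * (r * (a * q n r)) \<le> (a * r) * (N * (real r + \<beta> * a))"
    by (simp add: power2_eq_square mult_ac)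
  then have "r * (a * q n r) \<le> N * (real r + \<beta> * a)"
    using a r by (subst (asm) mult_le_cancel_left_pos) auto
  also have "\<dots> = r * N + \<epsilon> * (r * (a * q n r)) / (1 + \<epsilon>)"
  proof -
    have "N * \<beta> = \<epsilon> * (r * q n r) / (1 + \<epsilon>)"
      using N by (simp add: \<beta>_def)
    then have "N * \<beta> * a = \<epsilon> * (r * q n r) / (1 + \<epsilon>) * a" by simp
    also have "\<dots> = \<epsilon> * (r * (a * q n r)) / (1 + \<epsilon>)" by simp
    finally show ?thesis by (simp add: distrib_left)
  qed
  also have "\<dots> < r * (a * q n r) / (1 + \<epsilon>) + \<epsilon> * (r * (a * q n r)) / (1 + \<epsilon>)"
  proof -
    have "N < a * q n r / (1 + \<epsilon>)" using big' \<open>\<epsilon> > 0\<close> by (simp add: field_simps)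
    then have "real r * N < real r * (a * q n r / (1 + \<epsilon>))"
      using r by (intro mult_strict_left_mono) auto
    then show ?thesis by simp
  qed
  also have "\<dots> = r * (a * q n r)"
  proof -
    have "y / (1 + \<epsilon>) + \<epsilon> * y / (1 + \<epsilon>) = y" for y
    proof -
      have "y / (1 + \<epsilon>) + \<epsilon> * y / (1 + \<epsilon>) = (1 + \<epsilon>) * y / (1 + \<epsilon>)"
        by (simp only: add_divide_distrib distrib_right mult_1_left)
      then show ?thesis using \<open>\<epsilon> > 0\<close> by simp
    qed
    then show ?thesis .
  qed
  finally show False by simp
qed

section \<open>The nonbases around a nonbasis\<close>

context matroid
begin

lemma finite_indep: "X \<in> indep \<Longrightarrow> finite X"
  using indep_subset_ground finite_ground finite_subset by blast

definition rank :: nat where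
  "rank = Max (card ` indep)"

lemma finite_family: "finite indep"
  using finite_ground indep_subset_ground by (intro finite_subset[of indep "Pow E"]) auto

lemma card_le_rank: "X \<in> indep \<Longrightarrow> card X \<le> rank"
  unfolding rank_def using finite_family by (intro Max_ge) auto

lemma ex_basis: "\<exists>B\<in>indep. card B = rank"
proof -
  have "rank \<in> card ` indep"
    unfolding rank_def using finite_family empty_indep by (intro Max_in) auto
  then show ?thesis by auto
qed

lemma augment_to_basis:
  assumes "I \<in> indep" "B \<in> indep" "card B = rank"
  shows "\<exists>B'\<in>indep. card B' = rank \<and> I \<subseteq> B' \<and> B' \<subseteq> I \<union> B"
  using assms(1)
proof (induction "rank - card I" arbitrary: I)
  case 0
  then show ?case using card_le_rank[of I] by (intro bexI[of _ I]) auto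
next
  case (Suc k)
  then have "card I < card B" using assms by simp
  then obtain y where y: "y \<in> B - I" "insert y I \<in> indep"
    using indep_augment[of I B] Suc assms by auto
  have "k = rank - card (insert y I)"
    using Suc y finite_indep[of I] by simp
  from Suc(1)[OF this y(2)] show ?case using y by auto
qed

lemma basis_exchange:
  assumes "B1 \<in> indep" "card B1 = rank" "B2 \<in> indep" "card B2 = rank" "x \<in> B1 - B2"
  shows "\<exists>y\<in>B2 - B1. insert y (B1 - {x}) \<in> indep"
proof -
  have "B1 - {x} \<in> indep"
    using assms indep_hereditary[of B1 "B1 - {x}"] by auto
  moreover have "card (B1 - {x}) < card B2"
    using assms finite_indep[of B1] card_Diff1_less[of B1 x] by auto
  ultimately obtain y where "y \<in> B2 - (B1 - {x})" "insert y (B1 - {x}) \<in> indep"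
    using indep_augment[of "B1 - {x}" B2] assms by auto
  then show ?thesis using assms by (intro bexI[of _ y]) auto
qed

definition nonbases :: "'a set set" where
  "nonbases = {X. X \<subseteq> E \<and> card X = rank \<and> X \<notin> indep}"

text \<open>
  Let \<open>X\<close> be a nonbasis. If it has rank \<open>rank - 1\<close>, then \<open>X - forced_out
  X\<close> is the unique circuit contained in \<open>X\<close> and \<open>X \<union> forced_in
  X\<close> is the hyperplane spanned by \<open>X\<close>. If the rank of \<open>X\<close> is smaller
  still, no neighbour of \<open>X\<close> is a basis, and \<open>forced_out X\<close> and
  \<open>forced_in X\<close> are all of \<open>X\<close> and \<open>E - X\<close>.
\<close>

definition forced_out :: "'a set \<Rightarrow> 'a set" where
  "forced_out X = {e\<in>X. \<forall>f\<in>E - X. insert f (X - {e}) \<notin> indep}"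

definition forced_in :: "'a set \<Rightarrow> 'a set" where
  "forced_in X = {f\<in>E - X. \<forall>e\<in>X. insert f (X - {e}) \<notin> indep}"

lemma card_swap:
  assumes "finite X" "e \<in> X" "f \<notin> X"
  shows "card (insert f (X - {e})) = card X"
  using assms by (metis Diff_iff card_Suc_Diff1 card_insert_disjoint finite_Diff)

lemma nonbases_finite: "X \<in> nonbases \<Longrightarrow> finite X"
  using finite_ground finite_subset by (auto simp: nonbases_def)

text \<open>
  Let \<open>X - e + f'\<close> and \<open>X - e' + f\<close> be bases. Exchanging \<open>f'\<close>
  from the first basis for an element of the second can only bring in \<open>e\<close> or
  \<open>f\<close>. The former would make \<open>X\<close> a basis, so \<open>X - e + f\<close> is one.
\<close>

lemma swap_indep_iff:
  assumes X: "X \<in> nonbases" and e: "e \<in> X" and f: "f \<in> E - X"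
  shows "insert f (X - {e}) \<in> indep \<longleftrightarrow> e \<notin> forced_out X \<and> f \<notin> forced_in X"
proof (intro iffI)
  assume "e \<notin> forced_out X \<and> f \<notin> forced_in X"
  then obtain f' e' where f': "f' \<in> E - X" "insert f' (X - {e}) \<in> indep"
    and e': "e' \<in> X" "insert f (X - {e'}) \<in> indep"
    using e f by (auto simp: forced_out_def forced_in_def)
  show "insert f (X - {e}) \<in> indep"
  proof (cases "e = e' \<or> f = f'")
    case False
    let ?B1 = "insert f' (X - {e})" and ?B2 = "insert f (X - {e'})"
    have "card ?B1 = rank" "card ?B2 = rank"
      using card_swap[of X] X e f e' f' nonbases_finite[OF X] by (auto simp: nonbases_def)
    then obtain y where y: "y \<in> ?B2 - ?B1" "insert y (?B1 - {f'}) \<in> indep"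
      using basis_exchange[of ?B1 ?B2 f'] e' f' False by auto
    have B1: "?B1 - {f'} = X - {e}" using f' by auto
    have "y = e \<or> y = f" using y by auto
    moreover have "insert e (X - {e}) = X" using e by auto
    ultimately show ?thesis
      using y(2) X unfolding B1 by (auto simp: nonbases_def)
  qed (use f' e' in auto)
qed (use e f in \<open>auto simp: forced_out_def forced_in_def\<close>)

text \<open>
  If \<open>X - forced_out X\<close> were independent, then it could be extended to a basis by elements
  of the basis \<open>X - e + f\<close>. The result would lie in \<open>X + f\<close> and miss just one
  element of it, which is not \<open>f\<close> since \<open>X\<close> is not a basis. So it would be an
  element of \<open>forced_out X\<close> whose exchange for \<open>f\<close> yields a basis, a
  contradiction.
\<close>

lemma remaining_part_dependent:
  assumes X: "X \<in> nonbases" and e: "e \<in> X" and f: "f \<in> E - X"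
    and B0: "insert f (X - {e}) \<in> indep"
  shows "X - forced_out X \<notin> indep"
proof
  assume I: "X - forced_out X \<in> indep"
  let ?B0 = "insert f (X - {e})"
  have finX: "finite X" using nonbases_finite[OF X] .
  have "card ?B0 = rank"
    using card_swap[of X e f] X e f finX by (auto simp: nonbases_def)
  then obtain B where B: "B \<in> indep" "card B = rank" "X - forced_out X \<subseteq> B"
    "B \<subseteq> X - forced_out X \<union> ?B0"
    using augment_to_basis[OF I B0] by blast
  then have sub: "B \<subseteq> insert f X" by auto
  have cX: "card X = rank" "X \<notin> indep" using X by (auto simp: nonbases_def)
  have "f \<in> B"
  proof (rule ccontr)
    assume "f \<notin> B"
    then have "B \<subseteq> X" using sub by auto
    then have "B = X" using B(2) cX finX by (simp add: card_subset_eq)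
    then show False using B(1) cX by simp
  qed
  have "X - B \<noteq> {}"
  proof
    assume "X - B = {}"
    then have "insert f X \<subseteq> B" using \<open>f \<in> B\<close> by auto
    then have "card (insert f X) \<le> card B" using finite_indep[OF B(1)] by (intro card_mono)
    then show False using f finX B(2) cX by simp
  qed
  then obtain y where y: "y \<in> X" "y \<notin> B" by auto
  have "B \<subseteq> insert f (X - {y})" using sub y by auto
  moreover have "card (insert f (X - {y})) = card B"
    using card_swap[of X y f] finX f y B(2) cX by simp
  ultimately have "B = insert f (X - {y})"
    using finX by (intro card_subset_eq) auto
  moreover have "y \<in> forced_out X" using y B(3) by auto
  ultimately show False using B(1) f by (auto simp: forced_out_def)
qed

text \<open>
  Exchanging \<open>f\<close> from the basis \<open>X - e + f\<close> for an element of a basis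
  contained in \<open>X \<union> forced_in X\<close> would give either \<open>X\<close> itself or a
  basis \<open>X - e + y\<close> with \<open>y \<in> forced_in X\<close>, both of which are impossible.
\<close>

lemma closure_contains_no_basis:
  assumes X: "X \<in> nonbases" and e: "e \<in> X" and f: "f \<in> E - X"
    and B0: "insert f (X - {e}) \<in> indep" and B: "B \<in> indep" "card B = rank"
  shows "\<not> B \<subseteq> X \<union> forced_in X"
proof
  assume sub: "B \<subseteq> X \<union> forced_in X"
  let ?B0 = "insert f (X - {e})"
  have "f \<notin> forced_in X" using e B0 by (auto simp: forced_in_def)
  then have "f \<in> ?B0 - B" using sub f by auto
  moreover have "card ?B0 = rank"
    using card_swap[of X e f] X e f nonbases_finite[OF X] by (auto simp: nonbases_def)
  ultimately obtain y where y: "y \<in> B - ?B0" "insert y (?B0 - {f}) \<in> indep"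
    using basis_exchange[OF B0 _ B] by blast
  have "?B0 - {f} = X - {e}" using f by auto
  then have y2: "insert y (X - {e}) \<in> indep" using y by simp
  have "y \<noteq> e"
    using y2 e X by (auto simp: nonbases_def insert_absorb)
  then have "y \<in> forced_in X" using y sub by auto
  then show False using y2 e by (auto simp: forced_in_def)
qed

lemma indep_iff_nonbases:
  "indep = {I. \<exists>B. I \<subseteq> B \<and> B \<subseteq> E \<and> card B = rank \<and> B \<notin> nonbases}"
proof (intro equalityI subsetI)
  fix I assume I: "I \<in> indep"
  obtain B where "B \<in> indep" "card B = rank" using ex_basis by blast
  then obtain B' where "B' \<in> indep" "card B' = rank" "I \<subseteq> B'"
    using augment_to_basis[OF I] by blast
  then show "I \<in> {I. \<exists>B. I \<subseteq> B \<and> B \<subseteq> E \<and> card B = rank \<and> B \<notin> nonbases}"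
    using indep_subset_ground[of B'] by (auto simp: nonbases_def)
next
  fix I assume "I \<in> {I. \<exists>B. I \<subseteq> B \<and> B \<subseteq> E \<and> card B = rank \<and> B \<notin> nonbases}"
  then show "I \<in> indep" using indep_hereditary by (auto simp: nonbases_def)
qed

lemma rank_le_card: "rank \<le> card E"
  using ex_basis indep_subset_ground card_mono[OF finite_ground] by metis

end

section \<open>Encoding the nonbases of a matroid\<close>

text \<open>
  A patch is the set of nonbases around \<open>X\<close> that are explained by a pair \<open>(P,
  Q)\<close> of parts of \<open>forced_out X\<close> and \<open>forced_in X\<close>.
\<close>

definition patch :: "'a set \<Rightarrow> 'a set \<Rightarrow> 'a set \<Rightarrow> 'a set \<Rightarrow> 'a set set" where
  "patch E X P Q = insert X {insert f (X - {e}) |e f. e \<in> X \<and> f \<in> E - X \<and> (e \<in> P \<or> f \<in> Q)}"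

text \<open>
  The values that are recorded for an element \<open>X\<close> of the fingerprint: few in number,
  because \<open>P\<close> and \<open>Q\<close> are small. The whole ball is the value for those
  \<open>X\<close> without any neighbouring basis.
\<close>

definition patches :: "'a set \<Rightarrow> real \<Rightarrow> 'a set \<Rightarrow> 'a set set set" where
  "patches E t X = insert (johnson_ball E X)
     {patch E X P Q |P Q. P \<subseteq> E \<and> Q \<subseteq> E \<and> real (card P) \<le> t \<and> real (card Q) \<le> t}"

definition extreme_sets :: "'a set \<Rightarrow> nat \<Rightarrow> real \<Rightarrow> 'a set set" where
  "extreme_sets E r t = {C. C \<subseteq> E \<and> (real (card C) < real r - t \<or> real (card C) > real r + t)}"

definition comparable :: "'a set \<Rightarrow> nat \<Rightarrow> 'a set set \<Rightarrow> 'a set set" where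
  "comparable E r F = {Y. Y \<subseteq> E \<and> card Y = r \<and> (\<exists>C\<in>F. C \<subseteq> Y \<or> Y \<subseteq> C)}"

context matroid
begin

text \<open>
  A set with a comparable obstruction cannot be a basis. Depending on its size, an obstruction is a
  small dependent set, or a large set that does not span the matroid; as the two kinds are told
  apart by their sizes, one family serves for both.
\<close>

definition obstructions :: "real \<Rightarrow> 'a set set" where
  "obstructions t = {C \<in> extreme_sets E rank t.
     \<forall>B\<in>indep. card B = rank \<longrightarrow> \<not> C \<subseteq> B \<and> \<not> B \<subseteq> C}"

lemma comparable_obstructions: "comparable E rank (obstructions t) \<subseteq> nonbases"
  by (auto simp: comparable_def obstructions_def nonbases_def)

text \<open>
  If no neighbour of \<open>X\<close> is a basis, the whole ball is the patch. Otherwise use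
  \<open>forced_out X\<close> and \<open>forced_in X\<close> for the patch, each replaced by the empty
  set if it has more than \<open>t\<close> elements. A nonbasis that is lost by this replacement
  contains the obstruction \<open>X - forced_out X\<close> or is contained in the obstruction \<open>X
  \<union> forced_in X\<close>.
\<close>

lemma ball_nonbases_covered:
  assumes X: "X \<in> nonbases" and t: "t \<ge> 0"
  shows "\<exists>D\<in>patches E t X. D \<subseteq> nonbases \<and>
    nonbases \<inter> johnson_ball E X \<subseteq> D \<union> comparable E rank (obstructions t)"
proof (cases "\<forall>e\<in>X. \<forall>f\<in>E - X. insert f (X - {e}) \<notin> indep")
  case True
  have "johnson_ball E X \<subseteq> nonbases"
    using True X card_swap[of X] nonbases_finite[OF X] by (auto simp: johnson_ball_def nonbases_def)
  then show ?thesis by (intro bexI[of _ "johnson_ball E X"]) (auto simp: patches_def)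
next
  case False
  then obtain e0 f0 where e0: "e0 \<in> X" and f0: "f0 \<in> E - X" and ind: "insert f0 (X - {e0}) \<in> indep"
    by auto
  have X': "X \<subseteq> E" "card X = rank" "X \<notin> indep" "finite X"
    using X nonbases_finite[OF X] by (auto simp: nonbases_def)
  define small where "small S = (if real (card S) \<le> t then S else {})" for S :: "'a set"
  have small: "small S \<subseteq> S" "real (card (small S)) \<le> t" for S
    using t by (auto simp: small_def)
  have small_eq: "small S = S" if "real (card S) \<le> t" for S
    using that by (simp add: small_def)
  define D where "D = patch E X (small (forced_out X)) (small (forced_in X))"
  have fo: "forced_out X \<subseteq> X" and fi: "forced_in X \<subseteq> E - X"
    by (auto simp: forced_out_def forced_in_def)
  have "D \<in> patches E t X"
  proof -
    have "small (forced_out X) \<subseteq> E" "small (forced_in X) \<subseteq> E"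
      using order_trans[OF small(1) order_trans[OF fo X'(1)]] order_trans[OF small(1) order_trans[OF fi]]
      by simp_all
    then show ?thesis using small(2)[of "forced_out X"] small(2)[of "forced_in X"]
      unfolding D_def patches_def by blast
  qed
  moreover have "D \<subseteq> nonbases"
  proof
    fix Y assume "Y \<in> D"
    then have "Y = X \<or> (\<exists>e f. Y = insert f (X - {e}) \<and> e \<in> X \<and> f \<in> E - X \<and>
      (e \<in> small (forced_out X) \<or> f \<in> small (forced_in X)))"
      by (simp add: D_def patch_def)
    then consider "Y = X" | e f where "Y = insert f (X - {e})" "e \<in> X" "f \<in> E - X"
      "e \<in> forced_out X \<or> f \<in> forced_in X"
      using subsetD[OF small(1)] by metis
    then show "Y \<in> nonbases"
    proof cases
      case 2
      then have "Y \<notin> indep" "card Y = card X"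
        using swap_indep_iff[OF X] card_swap[of X e f] X' by auto
      then show ?thesis using 2 X' by (auto simp: nonbases_def)
    qed (use X in auto)
  qed
  moreover have "nonbases \<inter> johnson_ball E X \<subseteq> D \<union> comparable E rank (obstructions t)"
  proof
    fix Y assume Y: "Y \<in> nonbases \<inter> johnson_ball E X"
    then have YE: "Y \<subseteq> E" "card Y = rank" "Y \<notin> indep" by (auto simp: nonbases_def)
    show "Y \<in> D \<union> comparable E rank (obstructions t)"
    proof (cases "Y = X")
      case True
      then show ?thesis by (simp add: D_def patch_def)
    next
      case False
      then obtain e f where ef: "Y = insert f (X - {e})" "e \<in> X" "f \<in> E - X"
        using Y by (auto simp: johnson_ball_def)
      then consider "e \<in> small (forced_out X) \<or> f \<in> small (forced_in X)"
        | "e \<in> forced_out X" "real (card (forced_out X)) > t"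
        | "f \<in> forced_in X" "real (card (forced_in X)) > t"
        using swap_indep_iff[OF X ef(2,3)] YE(3) ef(1) small_eq linorder_not_le by metis
      then show ?thesis
      proof cases
        case 1
        then show ?thesis using ef unfolding D_def patch_def by blast
      next
        case 2
        define C where "C = X - forced_out X"
        have C: "C \<subseteq> X" "C \<notin> indep"
          using remaining_part_dependent[OF X e0 f0 ind] by (auto simp: C_def)
        have "card C + card (forced_out X) = rank"
          unfolding C_def X'(2)[symmetric] card_Diff_subset[OF finite_subset[OF fo X'(4)] fo]
          using card_mono[OF X'(4) fo] by simp
        then have "real (card C) < real rank - t" using 2 by linarith
        moreover have "\<not> C \<subseteq> B" if "B \<in> indep" for B
          using indep_hereditary[OF that] C by auto
        moreover have "\<not> B \<subseteq> C" if "B \<in> indep" "card B = rank" for B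
        proof
          assume "B \<subseteq> C"
          then have "B = X"
            using card_subset_eq[OF X'(4), of B] order_trans[OF _ C(1), of B] that X'(2) by simp
          then show False using that X'(3) by simp
        qed
        moreover have "C \<subseteq> E" using C(1) X'(1) by (rule order_trans)
        ultimately have "C \<in> obstructions t"
          unfolding obstructions_def extreme_sets_def by blast
        moreover have "C \<subseteq> Y" using ef 2 by (auto simp: C_def)
        ultimately show ?thesis using YE by (auto simp: comparable_def)
      next
        case 3
        define C where "C = X \<union> forced_in X"
        have C: "C \<subseteq> E" using X' fi by (auto simp: C_def)
        have "card C = rank + card (forced_in X)"
        proof -
          have "finite (forced_in X)" "X \<inter> forced_in X = {}"
            using fi finite_subset[OF fi] finite_ground by auto
          then show ?thesis unfolding C_def by (simp add: card_Un_disjoint X')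
        qed
        then have big: "real (card C) > real rank + t" using 3 by simp
        moreover have "\<not> B \<subseteq> C" if "B \<in> indep" "card B = rank" for B
          using closure_contains_no_basis[OF X e0 f0 ind that] by (simp add: C_def)
        moreover have "\<not> C \<subseteq> B" if "B \<in> indep" "card B = rank" for B
          using card_mono[OF finite_indep[OF that(1)], of C] that big t by auto
        ultimately have "C \<in> obstructions t"
          using C unfolding obstructions_def extreme_sets_def by blast
        moreover have "Y \<subseteq> C" using ef 3 by (auto simp: C_def)
        ultimately show ?thesis using YE by (auto simp: comparable_def)
      qed
    qed
  qed
  ultimately show ?thesis by blast
qed

end

lemma card_patches:
  assumes "finite E" "card E = n" "n \<ge> 1" "t \<ge> 0"
  shows "finite (patches E t X)"
    and "real (card (patches E t X)) \<le> 1 + (exp 1 * real n powr t)\<^sup>2"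
proof -
  let ?S = "{P. P \<subseteq> E \<and> real (card P) \<le> t}"
  have fin: "finite ?S" using assms(1) by (intro finite_subset[of ?S "Pow E"]) auto
  have eq: "patches E t X = insert (johnson_ball E X) ((\<lambda>(P, Q). patch E X P Q) ` (?S \<times> ?S))"
    by (auto simp: patches_def image_def)
  show "finite (patches E t X)" unfolding eq using fin by auto
  have "real (card ?S) \<le> (1 / real n) powr - t * exp (1 / real n * real (card E))"
    using assms by (intro card_small_subsets) auto
  also have "\<dots> = exp 1 * real n powr t"
    using assms by (simp add: powr_divide powr_minus field_simps)
  finally have S: "real (card ?S) \<le> exp 1 * real n powr t" .
  have "card (patches E t X) \<le> 1 + card ((\<lambda>(P, Q). patch E X P Q) ` (?S \<times> ?S))"
    unfolding eq using fin by (simp add: card_insert_le_m1 card_insert_if)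
  also have "\<dots> \<le> 1 + (card ?S)\<^sup>2"
    using card_image_le[of "?S \<times> ?S"] fin by (simp add: card_cartesian_product power2_eq_square)
  finally have "real (card (patches E t X)) \<le> 1 + (real (card ?S))\<^sup>2"
    by (metis of_nat_1 of_nat_add of_nat_le_iff of_nat_power)
  also have "(real (card ?S))\<^sup>2 \<le> (exp 1 * real n powr t)\<^sup>2"
    using S by (intro power_mono) auto
  finally show "real (card (patches E t X)) \<le> 1 + (exp 1 * real n powr t)\<^sup>2" by simp
qed

text \<open>
  The nonbases \<open>K\<close> are encoded by three items: the fingerprint \<open>S\<close> of
  \<open>K\<close> together with a patch for each of its elements, the set \<open>K \<inter> g
  S\<close>, and the family of obstructions. Their union, with the last item replaced by the sets
  comparable to an obstruction, is \<open>K\<close>. The four factors of the bound account for the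
  fingerprint with its patches (two factors, from \<open>card_small_subsets\<close>), for the subset of
  the container, and for the obstructions. The fingerprint and its patches form one set of
  \<^emph>\<open>tokens\<close>, pairs of an \<open>r\<close>-set and a patch, so that both are bounded
  at once.
\<close>

lemma card_nonbases_families_le:
  fixes \<epsilon> t x :: real and E :: "'a set"
  defines "N \<equiv> \<lambda>n r. real (n choose r)" and "q \<equiv> \<lambda>n r. real (n - r + 1)"
  assumes E: "finite E" "card E = n" and r: "1 \<le> r" "r \<le> n" and \<epsilon>: "\<epsilon> > 0" and t: "t \<ge> 0"
    and x: "0 < x" "x \<le> 1"
  shows "real (card {matroid.nonbases E I |I. matroid E I \<and> matroid.rank I = r}) \<le>
    x powr - (1 + ln (q n r) * (1 + \<epsilon>) * N n r / (\<epsilon> * real r * q n r))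
    * exp (x * (N n r * (1 + (exp 1 * real n powr t)\<^sup>2)))
    * 2 powr ((1 + \<epsilon>) * N n r / q n r)
    * 2 ^ card (extreme_sets E r t)"
proof -
  define V where "V = {X. X \<subseteq> E \<and> card X = r}"
  define T where "T = (1 + \<epsilon>) * N n r / q n r"
  define \<beta> where "\<beta> = \<epsilon> * real r * q n r / ((1 + \<epsilon>) * N n r)"
  define \<sigma> where "\<sigma> = 1 + ln (q n r) * (1 + \<epsilon>) * N n r / (\<epsilon> * real r * q n r)"
  have N: "N n r > 0" and q: "q n r \<ge> 1" using r by (auto simp: N_def q_def)
  have \<beta>: "\<beta> > 0" using N q \<epsilon> r by (auto simp: \<beta>_def)
  have finV: "finite V" using E by (intro finite_subset[of V "Pow E"]) (auto simp: V_def)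
  have cardV: "real (card V) = N n r" using E by (simp add: V_def N_def n_subsets)
  have "\<exists>v\<in>A. v \<in> johnson_ball E v \<and> real (card (A \<inter> johnson_ball E v)) \<ge> \<beta> * real (card A)"
    if "A \<subseteq> V" "real (card A) > T" for A
    using johnson_supersaturation[OF E r, of A \<epsilon>] that \<epsilon>
    by (auto simp: V_def T_def \<beta>_def N_def q_def johnson_ball_def)
  from container_fingerprint[of V T "johnson_ball E" \<beta>, OF finV this] have "\<exists>g. (\<forall>S. g S \<subseteq> V \<and> real (card (g S)) \<le> T) \<and>
    (\<forall>K\<subseteq>V. \<exists>S\<subseteq>K. K \<subseteq> g S \<union> \<Union>(johnson_ball E ` S) \<and>
        (S = {} \<or> T * exp (\<beta> * (real (card S) - 1)) < real (card V)))" .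
  then obtain g where gK: "(\<forall>S. g S \<subseteq> V \<and> real (card (g S)) \<le> T) \<and>
    (\<forall>K\<subseteq>V. \<exists>S\<subseteq>K. K \<subseteq> g S \<union> \<Union>(johnson_ball E ` S) \<and>
        (S = {} \<or> T * exp (\<beta> * (real (card S) - 1)) < real (card V)))" ..
  have g: "\<And>S. g S \<subseteq> V" "\<And>S. real (card (g S)) \<le> T"
    and fingerprint: "\<And>K. K \<subseteq> V \<Longrightarrow> \<exists>S\<subseteq>K. K \<subseteq> g S \<union> \<Union>(johnson_ball E ` S) \<and>
        (S = {} \<or> T * exp (\<beta> * (real (card S) - 1)) < real (card V))"
    using gK by simp_all
  have small: "real (card S) \<le> \<sigma>" if "S = {} \<or> T * exp (\<beta> * (real (card S) - 1)) < real (card V)"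
    for S :: "'a set set"
  proof (cases "S = {}")
    case True
    then show ?thesis using N q \<epsilon> r by (simp add: \<sigma>_def)
  next
    case False
    have "N n r / q n r * exp (\<beta> * (real (card S) - 1)) \<le> T * exp (\<beta> * (real (card S) - 1))"
      using \<epsilon> N q by (intro mult_right_mono) (auto simp: T_def divide_simps)
    also have "\<dots> < N n r" using that False cardV by simp
    finally have "exp (\<beta> * (real (card S) - 1)) < q n r"
      using N q by (simp add: field_simps)
    then have "\<beta> * (real (card S) - 1) < ln (q n r)"
      using q by (subst exp_less_cancel_iff[symmetric], subst exp_ln) auto
    then have "real (card S) - 1 < ln (q n r) / \<beta>"
      using \<beta> by (simp add: field_simps)
    also have "ln (q n r) / \<beta> = \<sigma> - 1"
      by (simp add: \<beta>_def \<sigma>_def)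
    finally show ?thesis by simp
  qed
  \<comment> \<open>All possible tokens; a code uses at most \<open>\<sigma>\<close> of them.\<close>
  define W where "W = (SIGMA X:V. patches E t X)"
  have n: "n \<ge> 1" using r by simp
  have finW: "finite W" unfolding W_def using finV card_patches(1)[OF E n t] by auto
  have "real (card W) = (\<Sum>X\<in>V. real (card (patches E t X)))"
    unfolding W_def using finV card_patches(1)[OF E n t] by simp
  also have "\<dots> \<le> (\<Sum>X\<in>V. 1 + (exp 1 * real n powr t)\<^sup>2)"
    using card_patches(2)[OF E n t] by (intro sum_mono)
  finally have cardW: "real (card W) \<le> N n r * (1 + (exp 1 * real n powr t)\<^sup>2)"
    using cardV by simp
  define tokens where "tokens = {S. S \<subseteq> W \<and> real (card S) \<le> \<sigma>}"
  have fin_tokens: "finite tokens"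
    using finW by (intro finite_subset[of tokens "Pow W"]) (auto simp: tokens_def)
  define U where "U = extreme_sets E r t"
  have finU: "finite U" using E by (intro finite_subset[of U "Pow E"]) (auto simp: U_def extreme_sets_def)
  define codes where "codes = (SIGMA S:tokens. Pow (g (fst ` S)) \<times> Pow U)"
  define decode where
    "decode = (\<lambda>(S :: ('a set \<times> 'a set set) set, A, F). A \<union> \<Union>(snd ` S) \<union> comparable E r F)"
  have fin_g: "finite (g S)" for S using g(1) finV finite_subset by blast
  have fin_codes: "finite codes"
    unfolding codes_def using fin_tokens fin_g finU by auto
  have "{matroid.nonbases E I |I. matroid E I \<and> matroid.rank I = r} \<subseteq> decode ` codes"
  proof
    fix K assume "K \<in> {matroid.nonbases E I |I. matroid E I \<and> matroid.rank I = r}"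
    then obtain I where "matroid E I" and I: "matroid.rank I = r" "K = matroid.nonbases E I"
      by auto
    interpret matroid E I by fact
    have K: "K = nonbases" using I by simp
    have KV: "K \<subseteq> V" using I by (auto simp: nonbases_def V_def)
    obtain S where S: "S \<subseteq> K" "K \<subseteq> g S \<union> \<Union>(johnson_ball E ` S)"
      "S = {} \<or> T * exp (\<beta> * (real (card S) - 1)) < real (card V)"
      using fingerprint[OF KV] by blast
    have "\<forall>X\<in>S. \<exists>D. D \<in> patches E t X \<and> D \<subseteq> nonbases \<and>
      nonbases \<inter> johnson_ball E X \<subseteq> D \<union> comparable E rank (obstructions t)"
    proof
      fix X assume "X \<in> S"
      then have "X \<in> nonbases" using S(1) K by auto
      then show "\<exists>D. D \<in> patches E t X \<and> D \<subseteq> nonbases \<and>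
        nonbases \<inter> johnson_ball E X \<subseteq> D \<union> comparable E rank (obstructions t)"
        using ball_nonbases_covered[OF _ t] by blast
    qed
    from bchoice[OF this] obtain D where D': "\<forall>X\<in>S. D X \<in> patches E t X \<and> D X \<subseteq> nonbases \<and>
      nonbases \<inter> johnson_ball E X \<subseteq> D X \<union> comparable E rank (obstructions t)" ..
    have D: "D X \<in> patches E t X" "D X \<subseteq> nonbases"
      "nonbases \<inter> johnson_ball E X \<subseteq> D X \<union> comparable E rank (obstructions t)" if "X \<in> S" for X
      using D' that by simp_all
    define S' where "S' = (\<lambda>X. (X, D X)) ` S"
    have fst_S': "fst ` S' = S" by (simp add: S'_def image_image)
    have snd_S': "\<Union>(snd ` S') = \<Union>(D ` S)" by (simp add: S'_def image_image)
    have "finite S" by (rule finite_subset[OF order_trans[OF S(1) KV] finV])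
    then have "card S' \<le> card S" unfolding S'_def by (rule card_image_le)
    then have "real (card S') \<le> \<sigma>" using small[OF S(3)] by linarith
    moreover have "S' \<subseteq> W"
      unfolding S'_def W_def using D(1) subsetD[OF order_trans[OF S(1) KV]] by (intro image_subsetI SigmaI)
    ultimately have "(S', K \<inter> g S, obstructions t) \<in> codes"
      unfolding codes_def tokens_def U_def I(1)[symmetric]
      by (intro SigmaI CollectI conjI PowI) (auto simp: fst_S' obstructions_def)
    moreover have "decode (S', K \<inter> g S, obstructions t) = K"
    proof
      show "decode (S', K \<inter> g S, obstructions t) \<subseteq> K"
      proof -
        have "\<Union>(D ` S) \<subseteq> nonbases" using D(2) by (rule UN_least)
        then show ?thesis
          using comparable_obstructions[of t] I(1) unfolding decode_def K prod.case snd_S' by auto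
      qed
      show "K \<subseteq> decode (S', K \<inter> g S, obstructions t)"
      proof
        fix Y assume Y: "Y \<in> K"
        show "Y \<in> decode (S', K \<inter> g S, obstructions t)"
        proof (cases "Y \<in> g S")
          case False
          then obtain X where "X \<in> S" "Y \<in> johnson_ball E X" using S(2) Y by blast
          then have "Y \<in> D X \<union> comparable E rank (obstructions t)"
            using D(3)[of X] Y K by blast
          then show ?thesis
            using \<open>X \<in> S\<close> I(1) unfolding decode_def prod.case snd_S' by auto
        qed (use Y in \<open>simp add: decode_def\<close>)
      qed
    qed
    ultimately show "K \<in> decode ` codes" by (metis image_eqI)
  qed
  then have "card {matroid.nonbases E I |I. matroid E I \<and> matroid.rank I = r} \<le> card (decode ` codes)"
    using fin_codes by (intro card_mono) auto
  also have "\<dots> \<le> card codes" using fin_codes by (rule card_image_le)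
  also have "\<dots> = (\<Sum>S\<in>tokens. 2 ^ card (g (fst ` S)) * 2 ^ card U)"
    unfolding codes_def using fin_tokens fin_g finU by (simp add: card_Pow card_cartesian_product)
  finally have "real (card {matroid.nonbases E I |I. matroid E I \<and> matroid.rank I = r})
      \<le> real (\<Sum>S\<in>tokens. 2 ^ card (g (fst ` S)) * 2 ^ card U)"
    by (rule of_nat_mono)
  also have "\<dots> = (\<Sum>S\<in>tokens. 2 powr real (card (g (fst ` S))) * 2 ^ card U)"
    by (simp add: powr_realpow)
  also have "\<dots> \<le> (\<Sum>S\<in>tokens. 2 powr T * 2 ^ card U)"
    using g(2) by (intro sum_mono mult_right_mono powr_mono) auto
  also have "\<dots> = real (card tokens) * 2 powr T * 2 ^ card U" by simp
  also have "\<dots> \<le> x powr - \<sigma> * exp (x * (N n r * (1 + (exp 1 * real n powr t)\<^sup>2))) * 2 powr T * 2 ^ card U"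
  proof (intro mult_right_mono)
    have "real (card tokens) \<le> x powr - \<sigma> * exp (x * real (card W))"
      unfolding tokens_def using finW x by (rule card_small_subsets)
    also have "\<dots> \<le> x powr - \<sigma> * exp (x * (N n r * (1 + (exp 1 * real n powr t)\<^sup>2)))"
      using x cardW by (intro mult_left_mono) auto
    finally show "real (card tokens) \<le> \<dots>" .
  qed auto
  finally show ?thesis by (simp add: \<sigma>_def T_def U_def)
qed

section \<open>Reduction to a fixed rank\<close>

lemma rank_fibre_le_Pow:
  assumes "finite E" "card E = n"
  shows "finite {matroid.nonbases E I |I. matroid E I \<and> matroid.rank I = r}"
    and "card {matroid.nonbases E I |I. matroid E I \<and> matroid.rank I = r} \<le> 2 ^ (n choose r)"
proof -
  let ?V = "{X. X \<subseteq> E \<and> card X = r}"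
  have sub: "{matroid.nonbases E I |I. matroid E I \<and> matroid.rank I = r} \<subseteq> Pow ?V"
    by (auto simp: matroid.nonbases_def)
  have fin: "finite ?V" using assms(1) by (intro finite_subset[of ?V "Pow E"]) auto
  show "finite {matroid.nonbases E I |I. matroid E I \<and> matroid.rank I = r}"
    using sub by (rule finite_subset) (use fin in simp)
  show "card {matroid.nonbases E I |I. matroid E I \<and> matroid.rank I = r} \<le> 2 ^ (n choose r)"
    using card_mono[OF _ sub] fin assms by (simp add: card_Pow n_subsets)
qed

lemma num_matroids_le_sum:
  "num_matroids n \<le>
    (\<Sum>r\<le>n. card {matroid.nonbases {1..n} I |I. matroid {1..n} I \<and> matroid.rank I = r})"
proof -
  let ?E = "{1..n}"
  let ?fam = "\<lambda>r. {matroid.nonbases ?E I |I. matroid ?E I \<and> matroid.rank I = r}"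
  let ?f = "\<lambda>I. (matroid.rank I, matroid.nonbases ?E I)"
  have "inj_on ?f (matroids_on ?E)"
  proof (rule inj_onI)
    fix I J assume IJ: "I \<in> matroids_on ?E" "J \<in> matroids_on ?E" and eq: "?f I = ?f J"
    have mI: "matroid ?E I" and mJ: "matroid ?E J" using IJ by (simp_all add: matroids_on_def)
    have "I = {I'. \<exists>B. I' \<subseteq> B \<and> B \<subseteq> ?E \<and> card B = matroid.rank I \<and> B \<notin> matroid.nonbases ?E I}"
      by (rule matroid.indep_iff_nonbases[OF mI])
    also have "\<dots> = {I'. \<exists>B. I' \<subseteq> B \<and> B \<subseteq> ?E \<and> card B = matroid.rank J \<and> B \<notin> matroid.nonbases ?E J}"
      using eq by simp
    also have "\<dots> = J"
      by (rule matroid.indep_iff_nonbases[OF mJ, symmetric])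
    finally show "I = J" .
  qed
  then have "num_matroids n = card (?f ` matroids_on ?E)"
    by (simp add: num_matroids_def card_image)
  also have "\<dots> \<le> card (SIGMA r:{..n}. ?fam r)"
  proof (rule card_mono)
    show "finite (SIGMA r:{..n}. ?fam r)"
      using rank_fibre_le_Pow(1)[of ?E n] by (intro finite_SigmaI) auto
    show "?f ` matroids_on ?E \<subseteq> (SIGMA r:{..n}. ?fam r)"
    proof
      fix p assume "p \<in> ?f ` matroids_on ?E"
      then obtain I where I: "p = ?f I" "matroid ?E I" by (auto simp: matroids_on_def)
      have "matroid.rank I \<le> n" using matroid.rank_le_card[OF I(2)] by simp
      then show "p \<in> (SIGMA r:{..n}. ?fam r)" using I by auto
    qed
  qed
  also have "\<dots> = (\<Sum>r\<le>n. card (?fam r))"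
    using rank_fibre_le_Pow(1)[of ?E n] by (intro card_SigmaI) auto
  finally show ?thesis .
qed

text \<open>
  This makes the inner logarithm of the final statement positive, as monotonicity of the outer one
  requires.
\<close>

lemma two_le_num_matroids:
  assumes "n \<ge> 1" shows "num_matroids n \<ge> 2"
proof -
  have "matroid {1..n} {{}}" by unfold_locales auto
  moreover have "matroid {1..n} (Pow {1..n})"
  proof unfold_locales
    fix X Y assume XY: "X \<in> Pow {1..n}" "Y \<in> Pow {1..n}" "card X < card Y"
    then have "finite X" using finite_subset by auto
    then have "\<not> Y \<subseteq> X" using card_mono[of X Y] XY(3) by auto
    then obtain y where "y \<in> Y" "y \<notin> X" by auto
    then show "\<exists>y\<in>Y - X. insert y X \<in> Pow {1..n}" using XY(1,2) by (intro bexI[of _ y]) auto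
  qed auto
  ultimately have "{{{}}, Pow {1..n}} \<subseteq> matroids_on {1..n}" by (simp add: matroids_on_def)
  moreover have "{{}} \<noteq> Pow {1..n}"
  proof
    assume "{{}} = Pow {1..n}"
    then have "{1..n} \<in> {{}}" by (simp only: Pow_top)
    then show False using assms by simp
  qed
  ultimately show ?thesis
    using card_mono[OF finite_matroids_on, of "{1..n}" "{{{}}, Pow {1..n}}"]
    by (simp add: num_matroids_def)
qed

section \<open>Asymptotics\<close>

text \<open>
  With \<open>rank_window n\<close> of order \<open>n^a\<close> for some \<open>1/2 < a < 1\<close>, the
  sets whose sizes lie outside the window around \<open>n/2\<close> are a fraction of all sets that is
  smaller than every power of \<open>1/n\<close>, and \<open>n/2\<close> remains the dominant term of
  \<open>min_rank\<close>. The cost of the fingerprint relative to the main term is of order \<open>n^(a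
  - 1) (ln n)^2 / slack n\<close>. It tends to 0 for \<open>a = 3/4\<close> and \<open>slack n =
  n^(-1/8)\<close>.
\<close>

definition rank_window :: "nat \<Rightarrow> real" where "rank_window n = real n powr (3/4)"
definition min_rank :: "nat \<Rightarrow> real" where "min_rank n = real n / 2 - rank_window n"
definition slack :: "nat \<Rightarrow> real" where "slack n = real n powr (-1/8)"
definition tail_bound :: "nat \<Rightarrow> real" where "tail_bound n = 2 * 2 ^ n * exp (- 2 * sqrt (real n))"
text \<open>
  Tokens are weighted by \<open>x = 2 powr - token_bits n\<close>. Up to a constant factor,
  \<open>x\<close> is \<open>1 / n^2\<close> divided by the bound \<open>n powr (4 * rank_window
  n)\<close> for the number of pairs \<open>(P, Q)\<close> of sets of size at most \<open>2 *
  rank_window n\<close>. This makes the total weight of all tokens at most \<open>(n choose r) /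
  n^2\<close>.
\<close>

definition token_bits :: "nat \<Rightarrow> real" where
  "token_bits n = log 2 10 + (4 * rank_window n + 2) * log 2 (real n)"

text \<open>
  The summands are the bits for choosing the tokens, the total weight of all tokens, the container, and
  the obstructions.
\<close>

definition rank_bound :: "nat \<Rightarrow> real" where
  "rank_bound n = (let M = real (n choose (n div 2)) in
    (1 + ln (real n) * (1 + slack n) * M / (slack n * min_rank n ^ 2)) * token_bits n
    + 2 * M / real n ^ 2 + (1 + slack n) * M / min_rank n + tail_bound n)"

lemma card_tail_window:
  assumes "finite E" "card E = n" "n > 0"
  shows "real (card {X. X \<subseteq> E \<and> \<bar>real (card X) - real n / 2\<bar> \<ge> rank_window n}) \<le> tail_bound n"
proof -
  have "(rank_window n)\<^sup>2 = real n powr (3/4 + 3/4)"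
    unfolding power2_eq_square rank_window_def powr_add[symmetric] ..
  also have "\<dots> = real n powr (1 + 1/2)" by simp
  also have "\<dots> = real n * sqrt (real n)"
    unfolding powr_add using assms by (simp add: powr_half_sqrt)
  finally have "- 2 * (rank_window n)\<^sup>2 / real n = - 2 * sqrt (real n)" using assms by simp
  then show ?thesis using card_tail[of E n "rank_window n"] assms
    by (simp add: tail_bound_def rank_window_def)
qed

text \<open>
  Outside the window the number of \<open>r\<close>-sets is itself below the bound, so that all families
  of \<open>r\<close>-sets may be counted. Inside it, \<open>r\<close> and \<open>n - r + 1\<close> are
  both at least \<open>min_rank n\<close>, and \<open>card_nonbases_families_le\<close> applies with
  \<open>t\<close> twice the width of the window: a set whose size is further than \<open>t\<close> from
  \<open>r\<close> is then itself outside the window.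
\<close>

lemma rank_fibre_bound:
  assumes n: "n > 0" and width: "min_rank n \<ge> 1" and r: "r \<le> n"
  shows "real (card {matroid.nonbases {1..n} I |I. matroid {1..n} I \<and> matroid.rank I = r})
    \<le> 2 powr rank_bound n"
proof -
  let ?E = "{1..n}"
  let ?fam = "{matroid.nonbases ?E I |I. matroid ?E I \<and> matroid.rank I = r}"
  define tail where "tail = {X. X \<subseteq> ?E \<and> \<bar>real (card X) - real n / 2\<bar> \<ge> rank_window n}"
  define M where "M = real (n choose (n div 2))"
  define N where "N = real (n choose r)"
  define q where "q = real (n - r + 1)"
  define d where "d = min_rank n"
  define \<epsilon> where "\<epsilon> = slack n"
  define L where "L = token_bits n"
  have fin_tail: "finite tail"
    unfolding tail_def by (rule finite_subset[of _ "Pow ?E"]) auto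
  have tail: "real (card tail) \<le> tail_bound n"
    unfolding tail_def by (rule card_tail_window) (use n in auto)
  have NM: "N \<le> M" unfolding N_def M_def by (simp add: binomial_maximum)
  have N: "N \<ge> 1" using r by (simp add: N_def Suc_le_eq)
  have \<epsilon>: "\<epsilon> > 0" using n by (simp add: \<epsilon>_def slack_def)
  have u: "rank_window n \<ge> 1"
    using n by (auto simp: rank_window_def intro: ge_one_powr_ge_zero)
  have d: "d \<ge> 1" using width by (simp add: d_def)
  have L: "L \<ge> 0"
    using n u by (auto simp: L_def token_bits_def intro!: add_nonneg_nonneg mult_nonneg_nonneg)
  have rb: "rank_bound n = (1 + ln (real n) * (1 + \<epsilon>) * M / (\<epsilon> * d ^ 2)) * L
    + 2 * M / real n ^ 2 + (1 + \<epsilon>) * M / d + tail_bound n"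
    by (simp add: rank_bound_def Let_def M_def d_def \<epsilon>_def L_def)
  have lnn: "ln (real n) \<ge> 0" using n by simp
  show ?thesis
  proof (cases "\<bar>real r - real n / 2\<bar> \<ge> rank_window n")
    case True
    have "{X. X \<subseteq> ?E \<and> card X = r} \<subseteq> tail" using True by (auto simp: tail_def)
    then have "card {X. X \<subseteq> ?E \<and> card X = r} \<le> card tail" using fin_tail by (rule card_mono[rotated])
    then have "real (n choose r) \<le> tail_bound n" using tail by (simp add: n_subsets)
    also have "\<dots> \<le> rank_bound n"
      unfolding rb using L lnn \<epsilon> d N NM by simp
    finally have "2 powr real (n choose r) \<le> 2 powr rank_bound n" by simp
    moreover have "real (card ?fam) \<le> real (2 ^ (n choose r))"
      using rank_fibre_le_Pow(2)[of ?E n r] by (intro of_nat_mono) simp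
    moreover have "real (2 ^ (n choose r)) = 2 powr real (n choose r)"
      by (simp add: powr_realpow)
    ultimately show ?thesis by linarith
  next
    case False
    define t where "t = 2 * rank_window n"
    define w where "w = 1 + (exp 1 * real n powr t)\<^sup>2"
    define x where "x = 2 powr - L"
    have rd: "d \<le> real r" and qd: "d \<le> q"
      using False r by (auto simp: d_def min_rank_def q_def of_nat_diff)
    have r1: "1 \<le> r" using rd d by linarith
    have qn: "q \<le> real n" using r1 r by (simp add: q_def)
    have x: "0 < x" "x \<le> 1" using L powr_mono[of "- L" 0 2] by (auto simp: x_def)
    have xw: "x * w \<le> 1 / real n ^ 2"
    proof -
      have ge1: "1 \<le> real n powr (2 * t)" using n u by (intro ge_one_powr_ge_zero) (auto simp: t_def)
      have "(exp 1 :: real)\<^sup>2 \<le> 3\<^sup>2" by (intro power_mono exp_le) auto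
      then have "(exp 1)\<^sup>2 * real n powr (2 * t) \<le> 9 * real n powr (2 * t)"
        by (intro mult_right_mono) auto
      moreover have "w = 1 + (exp 1)\<^sup>2 * real n powr (2 * t)"
        by (simp add: w_def power_mult_distrib power2_eq_square flip: powr_add)
      \<comment> \<open>Here \<open>e^2 < 9\<close> enters, and with the summand 1 it gives the constant 10 of \<open>token_bits\<close>.\<close>
      ultimately have w: "w \<le> 10 * real n powr (2 * t)" using ge1 by linarith
      have "2 powr L = 2 powr log 2 10 * 2 powr (log 2 (real n) * (4 * rank_window n + 2))"
        by (simp add: L_def token_bits_def powr_add mult.commute)
      also have "\<dots> = 10 * real n powr (2 * t + 2)"
        using n by (simp add: t_def flip: powr_powr)
      also have "\<dots> = 10 * real n powr (2 * t) * real n ^ 2"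
        using n by (simp add: powr_add)
      finally have "2 powr L = 10 * real n powr (2 * t) * real n ^ 2" .
      moreover have "x * w \<le> x * (10 * real n powr (2 * t))"
        using w x by (intro mult_left_mono) auto
      ultimately show ?thesis using n by (simp add: x_def powr_minus field_simps)
    qed
    have "extreme_sets ?E r t \<subseteq> tail"
      using False by (auto simp: extreme_sets_def tail_def t_def)
    then have "card (extreme_sets ?E r t) \<le> card tail" using fin_tail by (rule card_mono[rotated])
    then have ext: "real (card (extreme_sets ?E r t)) \<le> tail_bound n" using tail by linarith
    define \<sigma> where "\<sigma> = 1 + ln q * (1 + \<epsilon>) * N / (\<epsilon> * real r * q)"
    have \<sigma>: "\<sigma> \<le> 1 + ln (real n) * (1 + \<epsilon>) * M / (\<epsilon> * d ^ 2)"
    proof -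
      have "ln q * (1 + \<epsilon>) * N \<le> ln (real n) * (1 + \<epsilon>) * M"
        using qn qd d NM N \<epsilon> lnn by (intro mult_mono) auto
      moreover have "\<epsilon> * d ^ 2 \<le> \<epsilon> * real r * q"
        unfolding power2_eq_square mult.assoc using rd qd d \<epsilon> by (intro mult_left_mono mult_mono) auto
      ultimately show ?thesis
        unfolding \<sigma>_def using d \<epsilon> lnn N NM qd
        by (intro add_left_mono frac_le) auto
    qed
    have "real (card ?fam) \<le> x powr - \<sigma> * exp (x * (N * w)) * 2 powr ((1 + \<epsilon>) * N / q)
        * 2 ^ card (extreme_sets ?E r t)"
      unfolding \<sigma>_def N_def q_def w_def
      by (rule card_nonbases_families_le) (use r1 r \<epsilon> x u in \<open>auto simp: t_def\<close>)
    also have "\<dots> \<le> 2 powr (\<sigma> * L) * 2 powr (2 * (M / real n ^ 2)) * 2 powr ((1 + \<epsilon>) * M / d)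
        * 2 powr tail_bound n"
    proof (intro mult_mono)
      show "x powr - \<sigma> \<le> 2 powr (\<sigma> * L)"
        by (simp add: x_def powr_powr mult.commute)
      have "x * (N * w) = N * (x * w)" by simp
      also have "\<dots> \<le> M * (1 / real n ^ 2)"
        using xw NM N x by (intro mult_mono) (auto simp: w_def)
      finally have "exp (x * (N * w)) \<le> exp (1 * (M / real n ^ 2))" by simp
      \<comment> \<open>Passing from \<open>exp\<close> to powers of 2 costs a factor \<open>1 / ln 2 \<le> 2\<close> in the exponent.\<close>
      also have "\<dots> \<le> exp ((2 * ln 2) * (M / real n ^ 2))"
        using NM N ln2_ge_two_thirds by (subst exp_le_cancel_iff, intro mult_right_mono) auto
      also have "\<dots> = 2 powr (2 * (M / real n ^ 2))"
        by (simp add: powr_def)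
      finally show "exp (x * (N * w)) \<le> \<dots>" .
      show "2 powr ((1 + \<epsilon>) * N / q) \<le> 2 powr ((1 + \<epsilon>) * M / d)"
        using NM N qd d \<epsilon> by (intro powr_mono frac_le mult_left_mono) auto
      show "2 ^ card (extreme_sets ?E r t) \<le> 2 powr tail_bound n"
        using ext by (simp flip: powr_realpow)
    qed auto
    also have "\<dots> = 2 powr (\<sigma> * L + 2 * M / real n ^ 2 + (1 + \<epsilon>) * M / d + tail_bound n)"
      by (simp flip: powr_add)
    also have "\<dots> \<le> 2 powr rank_bound n"
      unfolding rb using \<sigma> L by (intro powr_mono add_right_mono mult_right_mono) auto
    finally show ?thesis .
  qed
qed

text \<open>
  The bound for \<open>log 2 (num_matroids n)\<close> in units of \<open>(n choose (n div 2)) /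
  n\<close>. The terms that are not proportional to the binomial coefficient are divided by it with the
  help of \<open>two_power_le_central\<close>. The limit 2 comes from the last summand, the size of the
  container.
\<close>

definition log_factor :: "nat \<Rightarrow> real" where
  "log_factor n = real n * (log 2 (real n + 1) + token_bits n + tail_bound n) * (real n + 1) / 2 ^ n
    + real n * ln (real n) * (1 + slack n) / (slack n * min_rank n ^ 2) * token_bits n
    + 2 / real n + (1 + slack n) * real n / min_rank n"

lemma log_factor_limit: "log_factor \<longlonglongrightarrow> 2"
  unfolding log_factor_def token_bits_def tail_bound_def min_rank_def slack_def rank_window_def
  by real_asymp

lemma eventually_min_rank: "\<forall>\<^sub>F n in sequentially. min_rank n \<ge> 1"
  unfolding min_rank_def rank_window_def by real_asymp

lemma log_num_matroids_le:
  assumes n: "n > 0" and width: "min_rank n \<ge> 1"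
  shows "log 2 (real (num_matroids n)) \<le> real (n choose (n div 2)) / real n * log_factor n"
proof -
  define M where "M = real (n choose (n div 2))"
  have M: "M > 0" by (simp add: M_def)
  have "real (num_matroids n) \<le> (\<Sum>r\<le>n. 2 powr rank_bound n)"
  proof -
    have "real (num_matroids n) \<le>
      real (\<Sum>r\<le>n. card {matroid.nonbases {1..n} I |I. matroid {1..n} I \<and> matroid.rank I = r})"
      by (intro of_nat_mono num_matroids_le_sum)
    also have "\<dots> \<le> (\<Sum>r\<le>n. 2 powr rank_bound n)"
      unfolding of_nat_sum using rank_fibre_bound[OF n width] by (intro sum_mono) auto
    finally show ?thesis .
  qed
  then have "real (num_matroids n) \<le> (real n + 1) * 2 powr rank_bound n" by (simp add: add.commute)
  then have "log 2 (real (num_matroids n)) \<le> log 2 ((real n + 1) * 2 powr rank_bound n)"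
    using two_le_num_matroids[of n] n by (subst log_le_cancel_iff) auto
  also have "\<dots> = log 2 (real n + 1) + rank_bound n"
    by (simp add: log_mult)
  finally have start: "log 2 (real (num_matroids n)) \<le> log 2 (real n + 1) + rank_bound n" .
  have split: "log 2 (real n + 1) + rank_bound n = (log 2 (real n + 1) + token_bits n + tail_bound n) +
     M / real n * (real n * ln (real n) * (1 + slack n) / (slack n * min_rank n ^ 2) * token_bits n
      + 2 / real n + (1 + slack n) * real n / min_rank n)"
  proof -
    have "M / real n * (a + b + c) = M / real n * a + M / real n * b + M / real n * c" for a b c
      by (simp only: distrib_left)
    moreover have "M / real n * ((1 + slack n) * real n / min_rank n) = (1 + slack n) * M / min_rank n"
      using n by simp
    moreover have "M / real n * (real n * ln (real n) * (1 + slack n) / (slack n * min_rank n ^ 2) * token_bits n)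
      = ln (real n) * (1 + slack n) * M / (slack n * min_rank n ^ 2) * token_bits n"
      using n by simp
    moreover have "M / real n * (2 / real n) = 2 * M / real n ^ 2"
      by (simp add: power2_eq_square)
    ultimately show ?thesis
      by (simp only: rank_bound_def Let_def M_def[symmetric] distrib_right[of 1] mult_1_left)
  qed
  have lower_order: "log 2 (real n + 1) + token_bits n + tail_bound n \<le>
      M / real n * (real n * (log 2 (real n + 1) + token_bits n + tail_bound n) * (real n + 1) / 2 ^ n)"
  proof -
    have "token_bits n \<ge> 0" "tail_bound n \<ge> 0" "log 2 (real n + 1) \<ge> 0"
      using n by (auto simp: token_bits_def tail_bound_def rank_window_def intro!: add_nonneg_nonneg mult_nonneg_nonneg)
    then have "(log 2 (real n + 1) + token_bits n + tail_bound n) * 1 \<le>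
      (log 2 (real n + 1) + token_bits n + tail_bound n) * (M * (real n + 1) / 2 ^ n)"
      using two_power_le_central[of n]
      by (intro mult_left_mono) (auto simp: M_def divide_simps mult.commute add.commute)
    then show ?thesis using n by (simp add: mult_ac)
  qed
  show ?thesis
    using start split lower_order unfolding log_factor_def M_def[symmetric]
    by (simp only: distrib_left[of "M / real n"] add.assoc)
qed

theorem theorem3:
  shows "\<exists>\<epsilon> :: nat \<Rightarrow> real. \<epsilon> \<longlonglongrightarrow> 0 \<and>
    (\<forall>n\<ge>1. log 2 (log 2 (real (num_matroids n)))
        \<le> real n - 3 / 2 * log 2 (real n) + 1 / 2 * log 2 (2 / pi) + 1 + \<epsilon> n)"
proof -
  define lhs where "lhs n = log 2 (log 2 (real (num_matroids n)))" for n
  define rhs where "rhs n = real n - 3 / 2 * log 2 (real n) + 1 / 2 * log 2 (2 / pi) + 1" for n :: nat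
  \<comment> \<open>The bound splits into the factor \<open>F n\<close> by which \<open>n choose (n div 2)\<close> exceeds \<open>2^n / sqrt n\<close>,
    which accounts for the constant \<open>sqrt (2 / pi)\<close>, and \<open>log_factor n\<close>, which accounts for the summand 1.\<close>
  define F where "F n = real (n choose (n div 2)) * sqrt (real n) / 2 ^ n" for n
  define \<delta> where "\<delta> n = log 2 (F n) - log 2 (sqrt (2 / pi)) + (log 2 (log_factor n) - log 2 2)" for n
  have "F \<longlonglongrightarrow> sqrt (2 / pi)"
    using central_binomial_limit by (simp add: F_def[abs_def])
  then have "\<delta> \<longlonglongrightarrow> log 2 (sqrt (2 / pi)) - log 2 (sqrt (2 / pi)) + (log 2 2 - log 2 2)"
    unfolding \<delta>_def[abs_def] by (intro tendsto_intros log_factor_limit) auto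
  then have \<delta>: "\<delta> \<longlonglongrightarrow> 0" by simp
  have bound: "\<forall>\<^sub>F n in sequentially. lhs n - rhs n \<le> \<delta> n"
    using eventually_gt_at_top[of 0] eventually_min_rank order_tendstoD(1)[OF log_factor_limit zero_less_numeral]
  proof eventually_elim
    case (elim n)
    define M where "M = real (n choose (n div 2))"
    have M: "M > 0" by (simp add: M_def)
    have FM: "M = F n * 2 ^ n / sqrt (real n)" using elim(1) by (simp add: F_def M_def)
    have F: "F n > 0" using elim(1) by (simp add: F_def)
    have "1 < real (num_matroids n)" using two_le_num_matroids[of n] elim(1) by simp
    then have "log 2 (real (num_matroids n)) > 0" by simp
    then have "lhs n \<le> log 2 (M / real n * log_factor n)"
      unfolding lhs_def using log_num_matroids_le[OF elim(1,2)] by (subst log_le_cancel_iff) (auto simp: M_def)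
    also have "\<dots> = log 2 M - log 2 (real n) + log 2 (log_factor n)"
      using elim M by (simp add: log_mult log_divide)
    also have "log 2 M = log 2 (F n) + real n - 1 / 2 * log 2 (real n)"
      proof -
      have "log 2 (sqrt (real n)) = 1 / 2 * log 2 (real n)"
        using elim(1) by (simp add: log_def ln_sqrt)
      then show ?thesis
        unfolding FM using F elim(1) by (simp add: log_mult log_divide log_nat_power)
    qed
    finally have "lhs n \<le> log 2 (F n) + real n - 3 / 2 * log 2 (real n) + log 2 (log_factor n)" by simp
    moreover have "log 2 (sqrt (2 / pi)) = 1 / 2 * log 2 (2 / pi)"
      by (simp add: log_def ln_sqrt)
    ultimately show ?case by (simp add: \<delta>_def rhs_def)
  qed
  \<comment> \<open>The maximum with 0 keeps the error term above 0, so that it is squeezed to 0,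
    and makes the inequality hold also for the finitely many \<open>n\<close> outside the estimate.\<close>
  define \<epsilon> where "\<epsilon> n = max 0 (lhs n - rhs n)" for n
  have "\<epsilon> \<longlonglongrightarrow> 0"
  proof (rule tendsto_sandwich)
    show "\<forall>\<^sub>F n in sequentially. 0 \<le> \<epsilon> n" by (simp add: \<epsilon>_def)
    show "\<forall>\<^sub>F n in sequentially. \<epsilon> n \<le> max 0 (\<delta> n)"
      using bound by eventually_elim (simp add: \<epsilon>_def)
    show "(\<lambda>n. max 0 (\<delta> n)) \<longlonglongrightarrow> 0"
      using tendsto_max[OF tendsto_const[of 0] \<delta>] by simp
  qed auto
  moreover have "\<forall>n\<ge>1. lhs n \<le> rhs n + \<epsilon> n"
  proof (intro allI impI)
    show "lhs n \<le> rhs n + \<epsilon> n" for n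
      using max.cobounded2[of "lhs n - rhs n" 0] unfolding \<epsilon>_def by linarith
  qed
  ultimately have "\<epsilon> \<longlonglongrightarrow> 0 \<and> (\<forall>n\<ge>1. lhs n \<le> rhs n + \<epsilon> n)" ..
  note limit_and_bound = this[unfolded lhs_def rhs_def]
  show ?thesis by (rule exI, rule limit_and_bound)
qed

end
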